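(* Let $n\ge 3$, let $B=B_{1/e}(0)\subset\mathbb{R}^n$, and let \[ \boldsymbol{b}(x)=-\frac{x}{|x|^2\ln|x|},\qquad x\in B . \] If Green's function $G(\cdot,y)=G_y(\cdot)$ for the operator $-\Delta u+\boldsymbol{b}\cdot\nabla u$ in $B$ exists, then it cannot belong to $L^1(B)$ uniformly in $y$ (that is, there is no constant $C$ with $\|G(\cdot,y)\|_{L^1(B)}\le C$ for almost every $y\in B$). In particular, the bounds \[ G(x,y)\le C|x-y|^{2-n},\qquad \|G(\cdot,y)\|_{L^{\frac{n}{n-2},\infty}(B)}\le C \] (with a constant $C$ independent of $x,y$) cannot hold.
   Context: For $\phi\in L^\infty(B)$, let $S\phi\in W_0^{1,2}(B)$ denote the unique weak solution $u$ of the adjoint equation $-\Delta u-\operatorname{div}(\boldsymbol{b}u)=\phi$ in $B$, i.e. $\int_B\nabla u\cdot\nabla\psi+\boldsymbol{b}\cdot\nabla\psi\,u=\int_B\phi\psi$ for all $\psi\in C_c^\infty(B)$. Green's function for the operator $-\Delta u+\boldsymbol{b}\cdot\nabla u$ in $B$ is a function $G(x,y)=G_y(x)$ on $B\times B$ such that $G_y\in L^1(B)$ for almost every $y\in B$ and, for every $\phi\in L^\infty(B)$, $S\phi(y)=\int_B G(x,y)\phi(x)\,dx$ for almost every $y\in B$. $L^{p,\infty}$ denotes weak $L^p$, $\|f\|_{L^{p,\infty}(B)}=\sup_{t>0}t\,|\{|f|\ge t\}|^{1/p}$. (One has $\boldsymbol b\in L^n(B)$ but $\boldsymbol b\notin L^p(B)$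 for $p>n$.) *)

theory Defs
  imports "HOL-Analysis.Analysis"
begin

subsection \<open>Smooth functions and test functions\<close>

primrec C_k :: "nat \<Rightarrow> ('a::euclidean_space \<Rightarrow> real) \<Rightarrow> bool" where
  "C_k 0 f \<longleftrightarrow> continuous_on UNIV f"
| "C_k (Suc k) f \<longleftrightarrow>
     (\<exists>D. (\<forall>x. GDERIV f x :> D x) \<and> (\<forall>i\<in>Basis. C_k k (\<lambda>x. D x \<bullet> i)))"

definition grad :: "('a::euclidean_space \<Rightarrow> real) \<Rightarrow> 'a \<Rightarrow> 'a" where
  "grad f x = (THE D. GDERIV f x :> D)"

text \<open>\<open>C\<^sub>c\<^sup>\<infinity>(\<Omega>)\<close>, its elements being extended by zero to the whole space.\<close>

definition test_functions :: "'a::euclidean_space set \<Rightarrow> ('a \<Rightarrow> real) set" where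
  "test_functions \<Omega> =
     {\<psi>. (\<forall>k. C_k k \<psi>) \<and> compact (closure {x. \<psi> x \<noteq> 0}) \<and> closure {x. \<psi> x \<noteq> 0} \<subseteq> \<Omega>}"

subsection \<open>Function spaces\<close>

text \<open>Elements of the spaces below are functions, not classes modulo equality almost
  everywhere; only their values on \<open>\<Omega>\<close> matter.\<close>

definition L_infty :: "'a::euclidean_space set \<Rightarrow> ('a \<Rightarrow> real) set" where
  "L_infty \<Omega> = {f. f \<in> borel_measurable (lebesgue_on \<Omega>) \<and>
                   (\<exists>M. AE x in lebesgue_on \<Omega>. \<bar>f x\<bar> \<le> M)}"

definition L_2 :: "'a::euclidean_space set \<Rightarrow> ('a \<Rightarrow> 'b::euclidean_space) set" where
  "L_2 \<Omega> = {f. f \<in> borel_measurable (lebesgue_on \<Omega>) \<and>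
               integrable (lebesgue_on \<Omega>) (\<lambda>x. (norm (f x))\<^sup>2)}"

definition L_2_tendsto ::
  "'a::euclidean_space set \<Rightarrow> (nat \<Rightarrow> 'a \<Rightarrow> 'b::euclidean_space) \<Rightarrow> ('a \<Rightarrow> 'b) \<Rightarrow> bool" where
  "L_2_tendsto \<Omega> f g \<longleftrightarrow>
     (\<lambda>k. LINT x|lebesgue_on \<Omega>. (norm (f k x - g x))\<^sup>2) \<longlonglongrightarrow> 0"

text \<open>\<open>u \<in> W\<^sup>1\<^sup>,\<^sup>2(\<Omega>)\<close> with weak gradient \<open>Du\<close>.\<close>

definition W_1_2 ::
  "'a::euclidean_space set \<Rightarrow> ('a \<Rightarrow> real) \<Rightarrow> ('a \<Rightarrow> 'a) \<Rightarrow> bool" where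
  "W_1_2 \<Omega> u Du \<longleftrightarrow> u \<in> L_2 \<Omega> \<and> Du \<in> L_2 \<Omega> \<and>
     (\<forall>\<psi>\<in>test_functions \<Omega>. \<forall>i\<in>Basis.
        (LINT x|lebesgue_on \<Omega>. u x * (grad \<psi> x \<bullet> i)) =
        - (LINT x|lebesgue_on \<Omega>. (Du x \<bullet> i) * \<psi> x))"

text \<open>\<open>u\<close> lies in the closure of \<open>C\<^sub>c\<^sup>\<infinity>(\<Omega>)\<close> in \<open>W\<^sup>1\<^sup>,\<^sup>2(\<Omega>)\<close>, and \<open>Du\<close> is its weak gradient.\<close>

definition W0_1_2 ::
  "'a::euclidean_space set \<Rightarrow> ('a \<Rightarrow> real) \<Rightarrow> ('a \<Rightarrow> 'a) \<Rightarrow> bool" where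
  "W0_1_2 \<Omega> u Du \<longleftrightarrow> W_1_2 \<Omega> u Du \<and>
     (\<exists>\<eta>. (\<forall>k. \<eta> k \<in> test_functions \<Omega>) \<and>
          L_2_tendsto \<Omega> \<eta> u \<and> L_2_tendsto \<Omega> (\<lambda>k. grad (\<eta> k)) Du)"

text \<open>The quasinorm of weak \<open>L\<^sup>p\<close>, for measurable \<open>f\<close> and \<open>\<Omega>\<close> of finite measure (otherwise
  \<open>measure\<close> may be \<open>0\<close> by convention).\<close>

definition weak_Lp_norm :: "'a::euclidean_space set \<Rightarrow> real \<Rightarrow> ('a \<Rightarrow> real) \<Rightarrow> ennreal" where
  "weak_Lp_norm \<Omega> p f =
     (SUP t\<in>{0<..}. ennreal (t * measure (lebesgue_on \<Omega>) {x\<in>\<Omega>. t \<le> \<bar>f x\<bar>} powr (1 / p)))"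

subsection \<open>The adjoint problem and Green's function\<close>

text \<open>Weak solutions \<open>u \<in> W\<^sub>0\<^sup>1\<^sup>,\<^sup>2(\<Omega>)\<close> of \<open>-\<Delta>u - div(b u) = \<phi>\<close>.\<close>

definition adjoint_weak_solution ::
  "'a::euclidean_space set \<Rightarrow> ('a \<Rightarrow> 'a) \<Rightarrow> ('a \<Rightarrow> real) \<Rightarrow> ('a \<Rightarrow> real) \<Rightarrow> bool" where
  "adjoint_weak_solution \<Omega> b \<phi> u \<longleftrightarrow>
     (\<exists>Du. W0_1_2 \<Omega> u Du \<and>
        (\<forall>\<psi>\<in>test_functions \<Omega>.
           (LINT x|lebesgue_on \<Omega>. Du x \<bullet> grad \<psi> x + (b x \<bullet> grad \<psi> x) * u x) =
           (LINT x|lebesgue_on \<Omega>. \<phi> x * \<psi> x)))"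

text \<open>Green's function of \<open>-\<Delta>u + b \<bullet> \<nabla>u\<close> in \<open>\<Omega>\<close>. The solution \<open>S\<phi>\<close> of the adjoint problem is an
  element of \<open>W\<^sub>0\<^sup>1\<^sup>,\<^sup>2(\<Omega>)\<close>, that is, a function determined almost everywhere; hence the
  quantification over all weak solutions \<open>u\<close>, which are the representatives of \<open>S\<phi>\<close>.\<close>

definition greens_function ::
  "'a::euclidean_space set \<Rightarrow> ('a \<Rightarrow> 'a) \<Rightarrow> ('a \<Rightarrow> 'a \<Rightarrow> real) \<Rightarrow> bool" where
  "greens_function \<Omega> b G \<longleftrightarrow>
     (AE y in lebesgue_on \<Omega>. integrable (lebesgue_on \<Omega>) (\<lambda>x. G x y)) \<and>
     (\<forall>\<phi>\<in>L_infty \<Omega>. \<forall>u. adjoint_weak_solution \<Omega> b \<phi> u \<longrightarrow>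
        (AE y in lebesgue_on \<Omega>. u y = (LINT x|lebesgue_on \<Omega>. G x y * \<phi> x)))"

definition log_drift :: "'a::euclidean_space \<Rightarrow> 'a" where
  "log_drift x = - (1 / ((norm x)\<^sup>2 * ln (norm x))) *\<^sub>R x"

end

theory Submission
  imports Defs
begin

text \<open>
  Write \<open>s = x \<bullet> x = \<bar>x\<bar>\<^sup>2\<close> and let \<open>n\<close> be the dimension. The proof exhibits a bounded nonnegative
  source \<open>\<phi>\<close> for which the adjoint problem has an unbounded weak solution \<open>u\<close>. As \<open>u(y)\<close> is the
  integral of \<open>G(x, y) \<phi>(x)\<close> over \<open>x\<close>, any majorant of \<open>G\<^sub>y\<close> whose integral is bounded uniformly in
  \<open>y\<close> would make \<open>u\<close> bounded (\<open>no_uniform_integrable_majorant\<close>). A bound of \<open>G\<^sub>y\<close> in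
  \<open>L\<^sup>1\<close> gives the majorant \<open>\<bar>G\<^sub>y\<bar>\<close>. The pointwise bound gives the majorant \<open>\<bar>C\<bar> \<bar>x - y\<bar>\<^sup>2\<^sup>-\<^sup>n\<close>; it
  is one-sided, which is why \<open>\<phi> \<ge> 0\<close> is important. Weak \<open>L\<^sup>p\<close> with \<open>p = n / (n - 2) > 1\<close> embeds into
  \<open>L\<^sup>1\<close> on a set of finite measure (\<open>weak_type_integral_bound\<close>).

  The solution comes from the fact that the drift is a gradient, \<open>b = - \<nabla> ln \<bar>ln \<bar>x\<bar>\<bar>\<close>. For a function
  of the form \<open>u = - ln \<bar>x\<bar> * w\<close> the flux is therefore \<open>\<nabla>u + b u = - ln \<bar>x\<bar> \<nabla>w\<close>: the logarithmic singularity
  of \<open>u\<close> is invisible where \<open>w\<close> is flat. The choice \<open>w = e\<^sup>-\<^sup>6 - \<bar>x\<bar>\<^sup>6\<close> vanishes on the boundary, is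
  positive at the origin, and gives the continuously differentiable flux \<open>3 s\<^sup>2 ln s x\<close>, hence the source
  \<open>\<phi> = - 3 s\<^sup>2 ((n + 4) ln s + 2)\<close>, which is bounded, and nonnegative since \<open>ln s < - 2\<close> in the ball.
  (With \<open>\<bar>x\<bar>\<^sup>2\<close> in place of \<open>\<bar>x\<bar>\<^sup>6\<close> the source would still contain an unbounded logarithm.)

  That \<open>u\<close> is in \<open>W\<^sub>0\<^sup>1\<^sup>,\<^sup>2\<close> is shown with explicit test functions: \<open>ln s\<close> becomes \<open>ln (s + 1 / N)\<close>,
  and \<open>w\<close> is cut off where \<open>w \<le> 1 / N\<close> by composing it with a rescaled copy of \<open>z exp (- 1 / z)\<close>, whose
  slope never exceeds \<open>1\<close>. These functions and their gradients are all dominated by \<open>7 / \<bar>x\<bar>\<close>, which is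
  square integrable for \<open>n \<ge> 3\<close>, so that everything follows by dominated convergence
  (\<open>W0_1_2_dominated_limit\<close>).
\<close>

section \<open>Smooth functions with explicit gradients\<close>

text \<open>With the powers of \<open>1 / t\<close> included, the span of this family is closed under differentiation,
so that smoothness of \<open>exp (- 1 / t)\<close> at \<open>0\<close> needs only first derivatives.\<close>

definition flat :: "nat \<Rightarrow> real \<Rightarrow> real" where
  "flat m t = (if 0 < t then exp (- (1 / t)) / t ^ m else 0)"

lemma flat_tendsto_0: "(flat m \<longlongrightarrow> 0) (at 0)"
proof -
  have "((\<lambda>z::real. z ^ m / exp z) \<longlongrightarrow> 0) at_top"
    by (rule tendsto_power_div_exp_0)
  then have "((\<lambda>t::real. (inverse t) ^ m / exp (inverse t)) \<longlongrightarrow> 0) (at_right 0)"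
    by (rule filterlim_compose) (rule filterlim_inverse_at_top_right)
  moreover have "\<forall>\<^sub>F t in at_right 0. (inverse t) ^ m / exp (inverse t) = flat m t"
    using eventually_at_right_less[of "0::real"]
    by eventually_elim (simp add: flat_def exp_minus field_simps power_inverse)
  ultimately have "(flat m \<longlongrightarrow> 0) (at_right 0)"
    by (rule Lim_transform_eventually)
  moreover have "(flat m \<longlongrightarrow> 0) (at_left 0)"
    by (rule Lim_transform_eventually[OF tendsto_const])
       (auto simp: eventually_at_left_field flat_def intro!: exI[of _ "-1"])
  ultimately show ?thesis
    by (simp add: filterlim_split_at)
qed

text \<open>At \<open>0\<close> the difference quotient of \<open>flat m\<close> is \<open>flat (m + 1)\<close>, which tends to \<open>0\<close>.\<close>

lemma flat_has_derivative:
  "(flat m has_real_derivative flat (m + 2) t - real m * flat (m + 1) t) (at t)"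
proof (cases t "0::real" rule: linorder_cases)
  case less
  have "((\<lambda>_. 0) has_real_derivative 0) (at t)"
    by simp
  then have "(flat m has_real_derivative 0) (at t)"
    by (rule has_field_derivative_transform_within_open[where S = "{..<0}"])
       (use less in \<open>auto simp: flat_def\<close>)
  with less show ?thesis
    by (simp add: flat_def)
next
  case equal
  have "((\<lambda>h. (flat m (0 + h) - flat m 0) / h) \<longlongrightarrow> 0) (at 0)"
    by (rule Lim_transform_eventually[OF flat_tendsto_0[of "Suc m"]])
       (simp add: flat_def eventually_at_filter)
  with equal show ?thesis
    by (simp add: DERIV_def flat_def)
next
  case greater
  have "((\<lambda>t. exp (- (1 / t)) / t ^ m) has_real_derivative flat (m + 2) t - real m * flat (m + 1) t) (at t)"
  proof (rule DERIV_cong)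
    show "((\<lambda>t. exp (- (1 / t)) / t ^ m) has_real_derivative
        (exp (- (1 / t)) * (1 / t\<^sup>2) * t ^ m - exp (- (1 / t)) * (real m * t ^ (m - Suc 0))) / (t ^ m * t ^ m)) (at t)"
      using greater
      by (intro DERIV_divide DERIV_pow) (auto intro!: derivative_eq_intros simp: power2_eq_square)
    show "(exp (- (1 / t)) * (1 / t\<^sup>2) * t ^ m - exp (- (1 / t)) * (real m * t ^ (m - Suc 0))) / (t ^ m * t ^ m)
        = flat (m + 2) t - real m * flat (m + 1) t"
      using greater by (cases m) (auto simp: flat_def field_simps power2_eq_square)
  qed
  then show ?thesis
    by (rule has_field_derivative_transform_within_open[where S = "{0<..}"])
       (use greater in \<open>auto simp: flat_def\<close>)
qed

text \<open>Smoothness is certified by the shape of a term. The class is closed under taking partial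
derivatives, which is all that is needed to iterate the definition of \<open>C_k\<close>.\<close>

inductive explicitly_smooth :: "('a::euclidean_space \<Rightarrow> real) \<Rightarrow> bool" where
  const: "explicitly_smooth (\<lambda>_. c)"
| linear: "explicitly_smooth (\<lambda>x. x \<bullet> v)"
| square: "explicitly_smooth (\<lambda>x. x \<bullet> x)"
| add: "explicitly_smooth f \<Longrightarrow> explicitly_smooth g \<Longrightarrow> explicitly_smooth (\<lambda>x. f x + g x)"
| mult: "explicitly_smooth f \<Longrightarrow> explicitly_smooth g \<Longrightarrow> explicitly_smooth (\<lambda>x. f x * g x)"
| inverse: "explicitly_smooth f \<Longrightarrow> (\<And>x. f x > 0) \<Longrightarrow> explicitly_smooth (\<lambda>x. inverse (f x))"
| ln: "explicitly_smooth f \<Longrightarrow> (\<And>x. f x > 0) \<Longrightarrow> explicitly_smooth (\<lambda>x. ln (f x))"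
| flat: "explicitly_smooth f \<Longrightarrow> explicitly_smooth (\<lambda>x. flat m (f x))"

lemma explicitly_smooth_gradient:
  assumes "explicitly_smooth (f :: 'a::euclidean_space \<Rightarrow> real)"
  shows "\<exists>D. (\<forall>x. GDERIV f x :> D x) \<and> (\<forall>v. explicitly_smooth (\<lambda>x. D x \<bullet> v))"
  using assms
proof (induction rule: explicitly_smooth.induct)
  case (const c)
  show ?case
    by (intro exI[of _ "\<lambda>_. 0"]) (auto simp: GDERIV_const intro: explicitly_smooth.intros)
next
  case (linear v)
  show ?case
    by (intro exI[of _ "\<lambda>_. v"]) (auto simp: gderiv_def intro!: derivative_eq_intros explicitly_smooth.intros)
next
  case square
  have "explicitly_smooth (\<lambda>x::'a. 2 * (x \<bullet> v))" for v :: 'a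
    by (intro explicitly_smooth.intros)
  then show ?case
    by (intro exI[of _ "\<lambda>x. 2 *\<^sub>R x"])
       (auto simp: gderiv_def inner_commute intro!: derivative_eq_intros)
next
  case (add f g)
  then obtain D E where "\<forall>x. GDERIV f x :> D x" "\<forall>v. explicitly_smooth (\<lambda>x. D x \<bullet> v)"
    "\<forall>x. GDERIV g x :> E x" "\<forall>v. explicitly_smooth (\<lambda>x. E x \<bullet> v)"
    by blast
  then show ?case
    by (intro exI[of _ "\<lambda>x. D x + E x"])
       (auto simp: inner_add_left intro!: GDERIV_add explicitly_smooth.add)
next
  case (mult f g)
  then obtain D E where "\<forall>x. GDERIV f x :> D x" "\<forall>v. explicitly_smooth (\<lambda>x. D x \<bullet> v)"
    "\<forall>x. GDERIV g x :> E x" "\<forall>v. explicitly_smooth (\<lambda>x. E x \<bullet> v)"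
    by blast
  with mult show ?case
    by (intro exI[of _ "\<lambda>x. f x *\<^sub>R E x + g x *\<^sub>R D x"])
       (auto simp: inner_add_left intro!: GDERIV_mult explicitly_smooth.add explicitly_smooth.mult)
next
  case (inverse f)
  then obtain D where D: "\<forall>x. GDERIV f x :> D x" "\<forall>v. explicitly_smooth (\<lambda>x. D x \<bullet> v)"
    by blast
  have "explicitly_smooth (\<lambda>x. (- 1 * (inverse (f x) * inverse (f x))) * (D x \<bullet> v))" for v
    by (intro explicitly_smooth.intros inverse D(2)[rule_format])
  then have "explicitly_smooth (\<lambda>x. (- (inverse (f x))\<^sup>2 *\<^sub>R D x) \<bullet> v)" for v
    by (simp add: power2_eq_square)
  moreover have "GDERIV (\<lambda>x. inverse (f x)) x :> - (inverse (f x))\<^sup>2 *\<^sub>R D x" for x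
    using D(1) inverse(2)[of x] by (intro GDERIV_inverse) auto
  ultimately show ?case
    by (intro exI[of _ "\<lambda>x. - (inverse (f x))\<^sup>2 *\<^sub>R D x"]) blast
next
  case (ln f)
  then obtain D where D: "\<forall>x. GDERIV f x :> D x" "\<forall>v. explicitly_smooth (\<lambda>x. D x \<bullet> v)"
    by blast
  have "explicitly_smooth (\<lambda>x. inverse (f x) * (D x \<bullet> v))" for v
    by (intro explicitly_smooth.intros ln D(2)[rule_format])
  then have "explicitly_smooth (\<lambda>x. (inverse (f x) *\<^sub>R D x) \<bullet> v)" for v
    by simp
  moreover have "GDERIV (\<lambda>x. ln (f x)) x :> inverse (f x) *\<^sub>R D x" for x
    by (rule GDERIV_DERIV_compose[OF D(1)[rule_format] DERIV_ln[OF ln(2)]])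
  ultimately show ?case
    by (intro exI[of _ "\<lambda>x. inverse (f x) *\<^sub>R D x"]) blast
next
  case (flat f m)
  then obtain D where D: "\<forall>x. GDERIV f x :> D x" "\<forall>v. explicitly_smooth (\<lambda>x. D x \<bullet> v)"
    by blast
  have "explicitly_smooth (\<lambda>x. (flat (m + 2) (f x) + (- real m) * flat (m + 1) (f x)) * (D x \<bullet> v))" for v
    by (intro explicitly_smooth.intros flat D(2)[rule_format])
  then have "explicitly_smooth (\<lambda>x. ((flat (m + 2) (f x) - real m * flat (m + 1) (f x)) *\<^sub>R D x) \<bullet> v)" for v
    by simp
  moreover have "GDERIV (\<lambda>x. flat m (f x)) x :> (flat (m + 2) (f x) - real m * flat (m + 1) (f x)) *\<^sub>R D x" for x
    by (rule GDERIV_DERIV_compose[OF D(1)[rule_format] flat_has_derivative])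
  ultimately show ?case
    by (intro exI[of _ "\<lambda>x. (flat (m + 2) (f x) - real m * flat (m + 1) (f x)) *\<^sub>R D x"]) blast
qed

lemma GDERIV_continuous_on:
  assumes "\<And>x. GDERIV f x :> D x"
  shows "continuous_on S f"
  using assms unfolding gderiv_def
  by (meson continuous_at_imp_continuous_on has_derivative_continuous)

lemma explicitly_smooth_C_k: "explicitly_smooth f \<Longrightarrow> C_k k f"
proof (induction k arbitrary: f)
  case 0
  then show ?case
    using explicitly_smooth_gradient[OF 0] GDERIV_continuous_on by auto
next
  case (Suc k)
  then show ?case
    using explicitly_smooth_gradient[OF Suc.prems] by fastforce
qed

section \<open>Integration by parts against test functions\<close>

lemma grad_eq: "GDERIV f x :> D \<Longrightarrow> grad f x = D"
  unfolding grad_def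
proof (rule the_equality)
  show "E = D" if "GDERIV f x :> D" "GDERIV f x :> E" for E
  proof -
    have "(\<lambda>h. h \<bullet> E) = (\<lambda>h. h \<bullet> D)"
      using that unfolding gderiv_def by (rule has_derivative_unique[rotated])
    then have "(E - D) \<bullet> (E - D) = 0"
      by (simp add: inner_diff_right fun_eq_iff)
    then show ?thesis
      by simp
  qed
qed

lemma GDERIV_along_line:
  assumes "GDERIV f (x + t *\<^sub>R i) :> D"
  shows "((\<lambda>t. f (x + t *\<^sub>R i)) has_real_derivative D \<bullet> i) (at t)"
proof -
  have "((\<lambda>t. x + t *\<^sub>R i) has_derivative (\<lambda>h. h *\<^sub>R i)) (at t)"
    by (auto intro!: derivative_eq_intros)
  from has_derivative_compose[OF this assms[unfolded gderiv_def]]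
  show ?thesis
    by (simp add: has_field_derivative_def inner_commute mult_commute_abs)
qed

lemma lborel_integral_translation:
  fixes f :: "'a::euclidean_space \<Rightarrow> real"
  assumes [measurable]: "f \<in> borel_measurable borel"
  shows "(LINT x|lborel. f (x + c)) = (LINT x|lborel. f x)"
proof -
  have "(LINT x|lborel. f x) = (LINT x|distr lborel borel ((+) c). f x)"
    by (simp add: lborel_distr_plus)
  also have "\<dots> = (LINT x|lborel. f (c + x))"
    by (rule integral_distr) simp_all
  finally show ?thesis
    by (simp add: add.commute)
qed

lemma integrable_lborel_bounded_support:
  fixes f :: "'a::euclidean_space \<Rightarrow> real"
  assumes [measurable]: "f \<in> borel_measurable borel"
    and "bounded S" and "\<And>x. x \<notin> S \<Longrightarrow> f x = 0" and "\<And>x. \<bar>f x\<bar> \<le> M"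
  shows "integrable lborel f"
proof -
  obtain r where "S \<subseteq> cball 0 r"
    using \<open>bounded S\<close> unfolding bounded_iff by (auto simp: subset_iff)
  then have "\<bar>f x\<bar> \<le> indicator (cball 0 r) x * M" for x
    using assms(3,4)[of x] by (cases "x \<in> S") (auto simp: indicator_def)
  moreover have "integrable lborel (\<lambda>x::'a. indicator (cball 0 r) x * M)"
    using emeasure_lborel_cball_finite[of "0::'a" r]
    by (intro integrable_mult_left) (simp add: integrable_indicator_iff)
  ultimately show ?thesis
    by (intro Bochner_Integration.integrable_bound[where f = "\<lambda>x. indicator (cball 0 r) x * M" and g = f] AE_I2)
       (auto simp: order_trans[OF _ abs_ge_self])
qed

text \<open>The integrals of the difference quotients of \<open>f\<close> vanish by translation invariance of Lebesgue
measure, and the quotients are bounded by the mean value theorem. Passing to the limit by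
dominated convergence avoids Fubini's theorem along coordinate lines.\<close>

lemma integral_partial_derivative_eq_0:
  fixes f :: "'a::euclidean_space \<Rightarrow> real"
  assumes deriv: "\<And>x. GDERIV f x :> D x"
    and "bounded S" and zero: "\<And>x. x \<notin> S \<Longrightarrow> f x = 0"
    and "norm i = 1" and bound: "\<And>x. \<bar>D x \<bullet> i\<bar> \<le> M"
  shows "(LINT x|lborel. D x \<bullet> i) = 0"
proof -
  define h where "h k = 1 / real (Suc k)" for k
  define q where "q k x = (f (x + h k *\<^sub>R i) - f x) / h k" for k x
  have h: "0 < h k" "h k \<le> 1" for k
    by (auto simp: h_def)
  have h_0: "h \<longlonglongrightarrow> 0"
    unfolding h_def using LIMSEQ_inverse_real_of_nat by (simp add: inverse_eq_divide)
  have cont: "continuous_on A f" for A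
    using deriv by (rule GDERIV_continuous_on)
  have [measurable]: "f \<in> borel_measurable borel"
    using cont by (rule borel_measurable_continuous_onI)
  have [measurable]: "q k \<in> borel_measurable borel" for k
    unfolding q_def by measurable
  obtain r where r: "S \<subseteq> cball 0 r"
    using \<open>bounded S\<close> unfolding bounded_iff by (auto simp: subset_iff)
  have "bounded (f ` cball 0 r)"
    by (intro compact_imp_bounded compact_continuous_image cont compact_cball)
  then obtain F where "\<forall>x\<in>cball 0 r. \<bar>f x\<bar> \<le> F"
    unfolding bounded_iff by auto
  with zero r have F: "\<bar>f x\<bar> \<le> \<bar>F\<bar>" for x
    by (cases "x \<in> cball 0 r") force+
  have f_int: "integrable lborel f"
    by (rule integrable_lborel_bounded_support[OF _ \<open>bounded S\<close> zero F]) auto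
  have f_int': "integrable lborel (\<lambda>x. f (x + c))" for c
  proof (rule integrable_lborel_bounded_support[of _ "cball (-c) r"])
    show "f (x + c) = 0" if "x \<notin> cball (- c) r" for x
    proof (rule zero)
      have "dist (- c) x = norm (- (x + c))"
        by (simp add: dist_norm algebra_simps)
      with that r show "x + c \<notin> S"
        unfolding norm_minus_cancel by auto
    qed
  qed (use F in auto)
  have "(LINT x|lborel. q k x) = 0" for k
    using f_int f_int'[of "h k *\<^sub>R i"]
    by (simp add: q_def lborel_integral_translation)
  moreover have "(\<lambda>k. LINT x|lborel. q k x) \<longlonglongrightarrow> (LINT x|lborel. D x \<bullet> i)"
  proof (rule integral_dominated_convergence[where w = "\<lambda>x. indicator (cball 0 (r + 1)) x * M"])
    have lim: "(\<lambda>k. q k x) \<longlonglongrightarrow> D x \<bullet> i" for x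
    proof -
      have "((\<lambda>t. f (x + t *\<^sub>R i)) has_real_derivative D x \<bullet> i) (at 0)"
        using deriv[of x] by (intro GDERIV_along_line) simp
      then have "((\<lambda>t. (f (x + t *\<^sub>R i) - f x) / t) \<longlongrightarrow> D x \<bullet> i) (at 0)"
        by (simp add: DERIV_def)
      then show ?thesis
        unfolding q_def
        by (rule filterlim_compose)
           (use h h_0 in \<open>auto simp: filterlim_at less_imp_neq[symmetric]\<close>)
    qed
    then show "AE x in lborel. (\<lambda>k. q k x) \<longlonglongrightarrow> D x \<bullet> i"
      by simp
    show "(\<lambda>x. D x \<bullet> i) \<in> borel_measurable lborel"
      by (rule borel_measurable_LIMSEQ_real[OF lim]) measurable
    show "integrable lborel (\<lambda>x::'a. indicator (cball 0 (r + 1)) x * M)"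
      using emeasure_lborel_cball_finite[of "0::'a" "r + 1"]
      by (intro integrable_mult_left) (simp add: integrable_indicator_iff)
    show "AE x in lborel. norm (q k x) \<le> indicator (cball 0 (r + 1)) x * M" for k
    proof (rule AE_I2)
      fix x
      show "norm (q k x) \<le> indicator (cball 0 (r + 1)) x * M"
      proof (cases "x \<in> cball 0 (r + 1)")
        case True
        obtain z where "f (x + h k *\<^sub>R i) - f (x + 0 *\<^sub>R i) = (h k - 0) * (D (x + z *\<^sub>R i) \<bullet> i)"
          using MVT2[OF h(1)[of k], of "\<lambda>t. f (x + t *\<^sub>R i)" "\<lambda>t. D (x + t *\<^sub>R i) \<bullet> i"]
            GDERIV_along_line[OF deriv] by blast
        with True bound show ?thesis
          using h(1)[of k] by (simp add: q_def)
      next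
        case False
        have "norm x \<le> norm (x + h k *\<^sub>R i) + norm (h k *\<^sub>R i)"
          by (metis add_diff_cancel_right' norm_triangle_ineq4)
        with False h[of k] \<open>norm i = 1\<close> have "x + h k *\<^sub>R i \<notin> cball 0 r" "x \<notin> cball 0 r"
          by auto
        with r have "x + h k *\<^sub>R i \<notin> S" "x \<notin> S"
          by blast+
        with zero have "q k x = 0"
          by (simp add: q_def)
        with False show ?thesis
          by simp
      qed
    qed
  qed auto
  ultimately show ?thesis
    by (simp add: LIMSEQ_const_iff)
qed

text \<open>Integrands cut off by a test function may be integrated over the whole space, where translations
are available.\<close>

lemma integral_lebesgue_on_eq_lborel:
  fixes f :: "'a::euclidean_space \<Rightarrow> real"
  assumes [measurable]: "f \<in> borel_measurable borel" and "\<Omega> \<in> sets borel"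
    and "\<And>x. x \<notin> \<Omega> \<Longrightarrow> f x = 0"
  shows "(LINT x|lebesgue_on \<Omega>. f x) = (LINT x|lborel. f x)"
proof -
  have "(LINT x|lebesgue_on \<Omega>. f x) = (LINT x|lebesgue. indicator \<Omega> x *\<^sub>R f x)"
    using assms(2) by (intro integral_restrict_space) auto
  also have "\<dots> = (LINT x|lebesgue. f x)"
    using assms(3) by (intro Bochner_Integration.integral_cong) (auto simp: indicator_def)
  also have "\<dots> = (LINT x|lborel. f x)"
    by (rule integral_completion) simp
  finally show ?thesis .
qed

lemma test_function_gradient:
  assumes "\<psi> \<in> test_functions \<Omega>"
  shows "GDERIV \<psi> x :> grad \<psi> x" and "continuous_on UNIV (grad \<psi>)" and "continuous_on UNIV \<psi>"
proof -
  have "C_k (Suc 0) \<psi>"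
    using assms unfolding test_functions_def by blast
  then obtain D where D: "\<And>x. GDERIV \<psi> x :> D x" "\<And>i. i \<in> Basis \<Longrightarrow> continuous_on UNIV (\<lambda>x. D x \<bullet> i)"
    by auto
  have "grad \<psi> = D"
    using D(1) by (intro ext grad_eq)
  with D GDERIV_continuous_on[OF D(1)]
  show "GDERIV \<psi> x :> grad \<psi> x" "continuous_on UNIV (grad \<psi>)" "continuous_on UNIV \<psi>"
    by (auto intro: continuous_on_componentwise[THEN iffD2])
qed

lemma zero_outside_support: "x \<notin> closure {x. f x \<noteq> 0} \<Longrightarrow> f x = 0"
  using closure_subset[of "{x. f x \<noteq> 0}"] by auto

lemma GDERIV_zero_outside_support:
  fixes f :: "'a::euclidean_space \<Rightarrow> real"
  assumes "GDERIV f x :> D" and "x \<notin> closure {x. f x \<noteq> 0}"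
  shows "D = 0"
proof -
  have "GDERIV (\<lambda>_. 0) x :> 0"
    by (rule GDERIV_const)
  then have "FDERIV f x :> (\<lambda>h. h \<bullet> 0)"
    unfolding gderiv_def
    by (rule has_derivative_transform_within_open[of _ _ x UNIV "- closure {x. f x \<noteq> 0}"])
       (use assms(2) closure_subset[of "{x. f x \<noteq> 0}"] in auto)
  then have "GDERIV f x :> 0"
    by (simp only: gderiv_def)
  with assms(1) show ?thesis
    by (auto dest!: grad_eq)
qed

lemma bounded_of_compact_support:
  fixes f :: "'a::topological_space \<Rightarrow> real"
  assumes "continuous_on UNIV f" "compact S" "\<And>x. x \<notin> S \<Longrightarrow> f x = 0"
  obtains M where "\<And>x. \<bar>f x\<bar> \<le> M"
proof -
  have "bounded (f ` S)"
    using assms by (intro compact_imp_bounded compact_continuous_image continuous_on_subset[OF assms(1)]) auto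
  then obtain M where "\<forall>x\<in>S. \<bar>f x\<bar> \<le> M"
    unfolding bounded_iff by auto
  then have "\<bar>f x\<bar> \<le> \<bar>M\<bar>" for x
    using assms(3)[of x] by (cases "x \<in> S") force+
  then show thesis
    by (rule that)
qed

lemma test_function_bounded:
  assumes "\<psi> \<in> test_functions \<Omega>"
  obtains M where "\<And>x. \<bar>\<psi> x\<bar> \<le> M" and "\<And>x. norm (grad \<psi> x) \<le> M"
proof -
  define S where "S = closure {x. \<psi> x \<noteq> 0}"
  have S: "compact S" "x \<notin> S \<Longrightarrow> \<psi> x = 0" for x
    using assms zero_outside_support[of x \<psi>] unfolding test_functions_def S_def by blast+
  note D = test_function_gradient[OF assms]
  obtain M where M: "\<And>x. \<bar>\<psi> x\<bar> \<le> M"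
    using bounded_of_compact_support[OF D(3) S] by blast
  have "norm (grad \<psi> x) = 0" if "x \<notin> S" for x
    using GDERIV_zero_outside_support[OF D(1)] that by (simp add: S_def)
  then obtain M' where M': "\<And>x. \<bar>norm (grad \<psi> x)\<bar> \<le> M'"
    using bounded_of_compact_support[OF continuous_on_norm[OF D(2)] S(1)] by blast
  show thesis
  proof (rule that)
    show "\<bar>\<psi> x\<bar> \<le> max M M'" "norm (grad \<psi> x) \<le> max M M'" for x
      using M[of x] M'[of x] by simp_all
  qed
qed

lemma integration_by_parts:
  fixes f :: "'a::euclidean_space \<Rightarrow> real"
  assumes \<psi>: "\<psi> \<in> test_functions \<Omega>" and "\<Omega> \<in> sets borel" and "i \<in> Basis"
    and f: "\<And>x. GDERIV f x :> D x" and D: "continuous_on UNIV (\<lambda>x. D x \<bullet> i)"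
  shows "(LINT x|lebesgue_on \<Omega>. f x * (grad \<psi> x \<bullet> i)) = - (LINT x|lebesgue_on \<Omega>. (D x \<bullet> i) * \<psi> x)"
proof -
  define S where "S = closure {x. \<psi> x \<noteq> 0}"
  have S: "compact S" "S \<subseteq> \<Omega>" "x \<notin> S \<Longrightarrow> \<psi> x = 0" for x
    using \<psi> zero_outside_support[of x \<psi>] unfolding test_functions_def S_def by blast+
  note g = test_function_gradient[OF \<psi>]
  have grad_0: "grad \<psi> x = 0" if "x \<notin> S" for x
    using GDERIV_zero_outside_support[OF g(1)] that by (simp add: S_def)
  have outside: "grad \<psi> x = 0" "\<psi> x = 0" if "x \<notin> \<Omega>" for x
    using that S(2,3) grad_0 by blast+
  have "continuous_on UNIV f"
    using f by (rule GDERIV_continuous_on)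
  then have c: "continuous_on UNIV (\<lambda>x. f x * (grad \<psi> x \<bullet> i))" "continuous_on UNIV (\<lambda>x. (D x \<bullet> i) * \<psi> x)"
    using g D by (auto intro!: continuous_intros)
  obtain M1 where M1: "\<And>x. \<bar>f x * (grad \<psi> x \<bullet> i)\<bar> \<le> M1"
    using bounded_of_compact_support[OF c(1) S(1)] grad_0 by auto
  obtain M2 where M2: "\<And>x. \<bar>(D x \<bullet> i) * \<psi> x\<bar> \<le> M2"
    using bounded_of_compact_support[OF c(2) S(1)] S(3) by auto
  note int =
    integrable_lborel_bounded_support[OF borel_measurable_continuous_onI[OF c(1)] compact_imp_bounded[OF S(1)] _ M1]
    integrable_lborel_bounded_support[OF borel_measurable_continuous_onI[OF c(2)] compact_imp_bounded[OF S(1)] _ M2]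
  have "(LINT x|lborel. (f x *\<^sub>R grad \<psi> x + \<psi> x *\<^sub>R D x) \<bullet> i) = 0"
  proof (rule integral_partial_derivative_eq_0[where f = "\<lambda>x. f x * \<psi> x" and M = "M1 + M2"])
    show "bounded S"
      using S(1) by (rule compact_imp_bounded)
    show "\<bar>(f x *\<^sub>R grad \<psi> x + \<psi> x *\<^sub>R D x) \<bullet> i\<bar> \<le> M1 + M2" for x
      using M1[of x] M2[of x] by (simp add: inner_add_left mult.commute)
  qed (use \<open>i \<in> Basis\<close> f g S(3) in \<open>auto intro!: GDERIV_mult\<close>)
  then have "(LINT x|lborel. f x * (grad \<psi> x \<bullet> i)) + (LINT x|lborel. (D x \<bullet> i) * \<psi> x) = 0"
    using int grad_0 S(3)
    by (subst Bochner_Integration.integral_add[symmetric]) (simp_all add: inner_add_left mult.commute)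
  moreover have "(LINT x|lebesgue_on \<Omega>. f x * (grad \<psi> x \<bullet> i)) = (LINT x|lborel. f x * (grad \<psi> x \<bullet> i))"
    using c(1) \<open>\<Omega> \<in> sets borel\<close> outside
    by (intro integral_lebesgue_on_eq_lborel) (auto intro: borel_measurable_continuous_onI)
  moreover have "(LINT x|lebesgue_on \<Omega>. (D x \<bullet> i) * \<psi> x) = (LINT x|lborel. (D x \<bullet> i) * \<psi> x)"
    using c(2) \<open>\<Omega> \<in> sets borel\<close> outside
    by (intro integral_lebesgue_on_eq_lborel) (auto intro: borel_measurable_continuous_onI)
  ultimately show ?thesis
    by simp
qed

section \<open>From weak-type bounds to integrability\<close>

lemma le_suminf: "f k \<le> (\<Sum>k. f k)" for f :: "nat \<Rightarrow> ennreal"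
  using sum_le_suminf[OF summableI, of "{k}" f] by simp

text \<open>On a finite measure space weak \<open>L\<^sup>p\<close> embeds into \<open>L\<^sup>1\<close> for \<open>p > 1\<close>, with a bound that depends
only on \<open>p\<close>, the total mass and the weak constant: splitting the values of \<open>f\<close> at the powers of two
gives \<open>\<bar>f\<bar> \<le> 1 + (\<Sum>k. 2^(k+1) * indicator {\<bar>f\<bar> \<ge> 2^k})\<close>, and the integrals on the right are dominated by a
geometric series of ratio \<open>2 powr (1 - p)\<close>.\<close>

lemma (in finite_measure) weak_type_integral_bound:
  fixes f :: "'a \<Rightarrow> real"
  assumes [measurable]: "f \<in> borel_measurable M" and "1 < p"
    and weak: "\<And>t. 0 < t \<Longrightarrow> measure M {x \<in> space M. t \<le> \<bar>f x\<bar>} \<le> A * t powr - p"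
  shows "integrable M f" and "(LINT x|M. \<bar>f x\<bar>) \<le> measure M (space M) + 2 * A / (1 - 2 powr (1 - p))"
proof -
  define r :: real where "r = 2 powr (1 - p)"
  have r: "0 < r" "r < 1"
    using \<open>1 < p\<close> by (auto simp: r_def intro!: powr_less_one)
  have "0 \<le> A"
    using weak[of 1] order_trans[OF measure_nonneg] by fastforce
  define E where "E k = {x \<in> space M. 2 ^ k \<le> \<bar>f x\<bar>}" for k :: nat
  have [measurable]: "E k \<in> sets M" for k
    unfolding E_def by measurable
  have dyadic: "ennreal \<bar>f x\<bar> \<le> 1 + (\<Sum>k. ennreal (2 ^ Suc k) * indicator (E k) x)" if "x \<in> space M" for x
  proof (cases "\<bar>f x\<bar> \<le> 1")
    case True
    then have "ennreal \<bar>f x\<bar> \<le> 1"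
      using ennreal_le_1 by blast
    then show ?thesis
      by (rule order_trans) simp
  next
    case False
    \<comment> \<open>\<open>n - 1\<close> is the index of the dyadic level containing \<open>\<bar>f x\<bar>\<close>.\<close>
    define n where "n = (LEAST n. \<bar>f x\<bar> < 2 ^ n)"
    have "\<exists>n. \<bar>f x\<bar> < 2 ^ n"
      using real_arch_pow[of 2 "\<bar>f x\<bar>"] by auto
    then have n: "\<bar>f x\<bar> < 2 ^ n"
      unfolding n_def by (rule LeastI_ex)
    with False obtain k where k: "n = Suc k"
      by (cases n) auto
    have "\<not> \<bar>f x\<bar> < 2 ^ k"
      using not_less_Least[of k "\<lambda>n. \<bar>f x\<bar> < 2 ^ n"] k by (simp add: n_def)
    with that have "x \<in> E k"
      by (simp add: E_def)
    then have "ennreal \<bar>f x\<bar> \<le> ennreal (2 ^ Suc k) * indicator (E k) x"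
      using n k by (simp add: ennreal_leI less_imp_le)
    also have "\<dots> \<le> (\<Sum>k. ennreal (2 ^ Suc k) * indicator (E k) x)"
      by (rule le_suminf)
    finally show ?thesis
      by (rule order_trans) simp
  qed
  have level: "ennreal (2 ^ Suc k) * emeasure M (E k) \<le> ennreal (2 * A * r ^ k)" for k
  proof -
    have "2 ^ Suc k * measure M (E k) \<le> 2 ^ Suc k * (A * (2 ^ k) powr - p)"
      using weak[of "2 ^ k"] by (intro mult_left_mono) (auto simp: E_def)
    also have "(2 ^ k) powr - p = 2 powr (- p * real k)"
      by (simp add: powr_realpow[symmetric] powr_powr mult.commute)
    also have "2 ^ Suc k * (A * 2 powr (- p * real k)) = 2 * A * (2 powr real k * 2 powr (- p * real k))"
      by (simp add: powr_realpow)
    also have "2 powr real k * 2 powr (- p * real k) = r ^ k"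
      by (simp add: r_def powr_add[symmetric] powr_realpow[symmetric] powr_powr algebra_simps)
    finally have "2 ^ Suc k * measure M (E k) \<le> 2 * A * r ^ k" .
    then show ?thesis
      by (simp add: emeasure_eq_measure ennreal_mult''[symmetric] ennreal_leI del: power_Suc)
  qed
  have "(\<integral>\<^sup>+x. ennreal \<bar>f x\<bar> \<partial>M) \<le> (\<integral>\<^sup>+x. 1 + (\<Sum>k. ennreal (2 ^ Suc k) * indicator (E k) x) \<partial>M)"
    using dyadic by (rule nn_integral_mono)
  also have "\<dots> = emeasure M (space M) + (\<Sum>k. ennreal (2 ^ Suc k) * emeasure M (E k))"
    by (simp add: nn_integral_add nn_integral_suminf nn_integral_cmult_indicator del: power_Suc)
  also have "\<dots> \<le> emeasure M (space M) + (\<Sum>k. ennreal (2 * A * r ^ k))"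
    by (intro add_left_mono suminf_le level) simp_all
  also have "(\<Sum>k. ennreal (2 * A * r ^ k)) = ennreal (2 * A / (1 - r))"
  proof -
    have "(\<lambda>k. 2 * A * r ^ k) sums (2 * A * (1 / (1 - r)))"
      using r by (intro sums_mult geometric_sums) auto
    then show ?thesis
      using \<open>0 \<le> A\<close> r by (subst suminf_ennreal_eq) auto
  qed
  also have "emeasure M (space M) + ennreal (2 * A / (1 - r)) = ennreal (measure M (space M) + 2 * A / (1 - r))"
    using \<open>0 \<le> A\<close> r by (simp add: emeasure_eq_measure ennreal_plus)
  finally have le: "(\<integral>\<^sup>+x. ennreal \<bar>f x\<bar> \<partial>M) \<le> ennreal (measure M (space M) + 2 * A / (1 - r))" .
  then show "integrable M f"
    by (intro integrableI_bounded) (auto simp: less_top[symmetric] top_unique)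
  then have "ennreal (LINT x|M. \<bar>f x\<bar>) = (\<integral>\<^sup>+x. ennreal \<bar>f x\<bar> \<partial>M)"
    by (subst nn_integral_eq_integral) auto
  with le have "ennreal (LINT x|M. \<bar>f x\<bar>) \<le> ennreal (measure M (space M) + 2 * A / (1 - r))"
    by simp
  moreover have "0 \<le> measure M (space M) + 2 * A / (1 - r)"
    using \<open>0 \<le> A\<close> r by simp
  ultimately show "(LINT x|M. \<bar>f x\<bar>) \<le> measure M (space M) + 2 * A / (1 - 2 powr (1 - p))"
    by (simp add: ennreal_le_iff r_def)
qed

lemma finite_measure_lebesgue_on_ball: "finite_measure (lebesgue_on (ball c r))"
  using emeasure_lborel_ball_finite[of c r]
  by (intro finite_measureI) (simp add: emeasure_restrict_space)

text \<open>The superlevel sets of \<open>\<bar>x - y\<bar>\<^sup>-\<^sup>q\<close> are balls around \<open>y\<close>, so this function lies in weak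
\<open>L\<^sup>n\<^sup>/\<^sup>q\<close> with a constant that does not depend on \<open>y\<close>.\<close>

lemma norm_powr_integral_bound:
  fixes c :: "'a::euclidean_space"
  assumes "0 < q" and "q < real DIM('a)"
  obtains C where "\<And>y. integrable (lebesgue_on (ball c R)) (\<lambda>x. norm (x - y) powr - q)"
    and "\<And>y. (LINT x|lebesgue_on (ball c R). norm (x - y) powr - q) \<le> C"
proof -
  interpret finite_measure "lebesgue_on (ball c R)"
    by (rule finite_measure_lebesgue_on_ball)
  define p where "p = real DIM('a) / q"
  define A where "A = unit_ball_vol (real DIM('a))"
  have "1 < p"
    using assms by (simp add: p_def)
  have meas: "(\<lambda>x. norm (x - y) powr - q) \<in> borel_measurable (lebesgue_on (ball c R))" for y :: 'a
    by (intro measurable_restrict_space1 measurable_completion) measurable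
  have weak: "measure (lebesgue_on (ball c R))
      {x \<in> space (lebesgue_on (ball c R)). t \<le> \<bar>norm (x - y) powr - q\<bar>} \<le> A * t powr - p"
    if "0 < t" for t and y :: 'a
  proof -
    define L where "L = {x \<in> ball c R. t \<le> norm (x - y) powr - q}"
    have sub: "L \<subseteq> cball y (t powr (- 1 / q))"
    proof
      fix x assume "x \<in> L"
      then have x: "t \<le> norm (x - y) powr - q"
        by (simp add: L_def)
      with \<open>0 < t\<close> have "0 < norm (x - y)"
        by (cases "x = y") auto
      have "norm (x - y) = (norm (x - y) powr - q) powr (- 1 / q)"
        using \<open>0 < norm (x - y)\<close> \<open>0 < q\<close> by (simp add: powr_powr)
      also have "\<dots> \<le> t powr (- 1 / q)"
        using x \<open>0 < t\<close> \<open>0 < q\<close> by (intro powr_mono2') auto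
      finally show "x \<in> cball y (t powr (- 1 / q))"
        by (simp add: dist_norm norm_minus_commute)
    qed
    have L: "L \<in> sets borel"
      unfolding L_def by measurable
    have "measure (lebesgue_on (ball c R)) L = measure lborel L"
      using L by (subst measure_restrict_space) (auto simp: L_def)
    also have "\<dots> \<le> measure lborel (cball y (t powr (- 1 / q)))"
      using L emeasure_lborel_cball_finite[of y "t powr (- 1 / q)"]
      by (intro measure_mono_fmeasurable sub) (auto simp: fmeasurable_def)
    also have "\<dots> = A * (t powr (- 1 / q)) ^ DIM('a)"
      by (simp add: content_cball A_def)
    also have "(t powr (- 1 / q)) ^ DIM('a) = t powr - p"
      using \<open>0 < t\<close> by (simp add: powr_realpow[symmetric] powr_powr p_def)
    finally show ?thesis
      by (simp add: L_def)
  qed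
  show thesis
  proof (rule that)
    show "integrable (lebesgue_on (ball c R)) (\<lambda>x. norm (x - y) powr - q)" for y
      using meas \<open>1 < p\<close> weak by (rule weak_type_integral_bound(1))
    show "(LINT x|lebesgue_on (ball c R). norm (x - y) powr - q)
        \<le> measure (lebesgue_on (ball c R)) (space (lebesgue_on (ball c R))) + 2 * A / (1 - 2 powr (1 - p))" for y
      using weak_type_integral_bound(2)[OF meas \<open>1 < p\<close> weak, of y] by simp
  qed
qed

section \<open>Dominated limits of test functions\<close>

lemma dominated_square_integrable:
  fixes f :: "'a \<Rightarrow> 'b::euclidean_space"
  assumes "f \<in> borel_measurable M" and "integrable M (\<lambda>x. (d x)\<^sup>2)"
    and "AE x in M. norm (f x) \<le> d x"
  shows "integrable M (\<lambda>x. (norm (f x))\<^sup>2)"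
proof (rule Bochner_Integration.integrable_bound[OF assms(2)])
  show "AE x in M. norm ((norm (f x))\<^sup>2) \<le> norm ((d x)\<^sup>2)"
    using assms(3) by eventually_elim (simp add: power_mono)
qed (use assms(1) in measurable)

lemma L_2_tendsto_dominated:
  fixes f :: "nat \<Rightarrow> 'a::euclidean_space \<Rightarrow> 'b::euclidean_space"
  assumes [measurable]: "\<And>k. f k \<in> borel_measurable (lebesgue_on \<Omega>)" "g \<in> borel_measurable (lebesgue_on \<Omega>)"
    and d: "integrable (lebesgue_on \<Omega>) (\<lambda>x. (d x)\<^sup>2)"
    and bound: "\<And>k. AE x in lebesgue_on \<Omega>. norm (f k x) \<le> d x"
    and lim: "AE x in lebesgue_on \<Omega>. (\<lambda>k. f k x) \<longlonglongrightarrow> g x"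
  shows "g \<in> L_2 \<Omega>" and "L_2_tendsto \<Omega> f g"
proof -
  have "AE x in lebesgue_on \<Omega>. \<forall>k. norm (f k x) \<le> d x"
    using bound by (simp add: AE_all_countable)
  with lim have g: "AE x in lebesgue_on \<Omega>. norm (g x) \<le> d x"
    by eventually_elim (auto intro: LIMSEQ_le_const2 tendsto_norm)
  with d show "g \<in> L_2 \<Omega>"
    by (auto simp: L_2_def intro: dominated_square_integrable)
  have "(\<lambda>k. LINT x|lebesgue_on \<Omega>. (norm (f k x - g x))\<^sup>2) \<longlonglongrightarrow> (LINT x|lebesgue_on \<Omega>. 0)"
  proof (rule integral_dominated_convergence[where w = "\<lambda>x. 4 * (d x)\<^sup>2"])
    show "AE x in lebesgue_on \<Omega>. (\<lambda>k. (norm (f k x - g x))\<^sup>2) \<longlonglongrightarrow> 0"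
      using lim
    proof eventually_elim
      case (elim x)
      then have "(\<lambda>k. (norm (f k x - g x))\<^sup>2) \<longlonglongrightarrow> (norm (g x - g x))\<^sup>2"
        by (intro tendsto_intros)
      then show ?case
        by simp
    qed
    show "AE x in lebesgue_on \<Omega>. norm ((norm (f k x - g x))\<^sup>2) \<le> 4 * (d x)\<^sup>2" for k
      using bound[of k] g
    proof eventually_elim
      case (elim x)
      then have "norm (f k x - g x) \<le> 2 * d x"
        using norm_triangle_ineq4[of "f k x" "g x"] by linarith
      then have "(norm (f k x - g x))\<^sup>2 \<le> (2 * d x)\<^sup>2"
        by (rule power_mono) simp
      then show ?case
        by (simp add: power_mult_distrib)
    qed
  qed (use d in auto)
  then show "L_2_tendsto \<Omega> f g"
    by (simp add: L_2_tendsto_def)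
qed

lemma borel_measurable_lebesgue_onI:
  "f \<in> borel_measurable borel \<Longrightarrow> f \<in> borel_measurable (lebesgue_on \<Omega>)"
  by (intro measurable_restrict_space1 measurable_completion) simp

text \<open>A single majorant \<open>d\<close> for the approximants and their gradients gives everything at once: \<open>d\<^sup>2\<close>
dominates the \<open>L\<^sup>2\<close> distances, and \<open>d\<close> itself dominates both sides of the integration by parts
that identifies \<open>Du\<close> as the weak gradient.\<close>

lemma W0_1_2_dominated_limit:
  fixes u :: "'a::euclidean_space \<Rightarrow> real"
  assumes "\<Omega> \<in> sets borel"
    and test: "\<And>k. \<eta> k \<in> test_functions \<Omega>"
    and u [measurable]: "u \<in> borel_measurable borel" and Du [measurable]: "Du \<in> borel_measurable borel"
    and d1: "integrable (lebesgue_on \<Omega>) d" and d2: "integrable (lebesgue_on \<Omega>) (\<lambda>x. (d x)\<^sup>2)"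
    and bound: "\<And>k. AE x in lebesgue_on \<Omega>. \<bar>\<eta> k x\<bar> \<le> d x"
      "\<And>k. AE x in lebesgue_on \<Omega>. norm (grad (\<eta> k) x) \<le> d x"
    and lim: "AE x in lebesgue_on \<Omega>. (\<lambda>k. \<eta> k x) \<longlonglongrightarrow> u x"
      "AE x in lebesgue_on \<Omega>. (\<lambda>k. grad (\<eta> k) x) \<longlonglongrightarrow> Du x"
  shows "W0_1_2 \<Omega> u Du"
proof -
  have meas_\<eta>: "\<eta> k \<in> borel_measurable borel" "grad (\<eta> k) \<in> borel_measurable borel" for k
    using test_function_gradient[OF test[of k]] by (auto intro: borel_measurable_continuous_onI)
  note meas = meas_\<eta>[THEN borel_measurable_lebesgue_onI] u[THEN borel_measurable_lebesgue_onI]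
    Du[THEN borel_measurable_lebesgue_onI]
  note L2_u = L_2_tendsto_dominated[of \<eta> \<Omega> u d, unfolded real_norm_def, OF meas(1,3) d2 bound(1) lim(1)]
  note L2_Du = L_2_tendsto_dominated[of "\<lambda>k. grad (\<eta> k)" \<Omega> Du d, OF meas(2,4) d2 bound(2) lim(2)]
  have "(LINT x|lebesgue_on \<Omega>. u x * (grad \<psi> x \<bullet> i)) = - (LINT x|lebesgue_on \<Omega>. (Du x \<bullet> i) * \<psi> x)"
    if \<psi>: "\<psi> \<in> test_functions \<Omega>" and i: "i \<in> Basis" for \<psi> i
  proof -
    obtain M where M: "\<And>x. \<bar>\<psi> x\<bar> \<le> M" "\<And>x. norm (grad \<psi> x) \<le> M"
      using test_function_bounded[OF \<psi>] by blast
    have meas_\<psi>: "\<psi> \<in> borel_measurable borel" "(\<lambda>x. grad \<psi> x \<bullet> i) \<in> borel_measurable borel"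
      using test_function_gradient[OF \<psi>] by (auto intro!: borel_measurable_continuous_onI continuous_intros)
    have parts: "(LINT x|lebesgue_on \<Omega>. \<eta> k x * (grad \<psi> x \<bullet> i)) = - (LINT x|lebesgue_on \<Omega>. (grad (\<eta> k) x \<bullet> i) * \<psi> x)" for k
      using test_function_gradient[OF test[of k]]
      by (intro integration_by_parts \<psi> \<open>\<Omega> \<in> sets borel\<close> i continuous_intros)
    have "(\<lambda>k. LINT x|lebesgue_on \<Omega>. \<eta> k x * (grad \<psi> x \<bullet> i)) \<longlonglongrightarrow> (LINT x|lebesgue_on \<Omega>. u x * (grad \<psi> x \<bullet> i))"
    proof (rule integral_dominated_convergence[where w = "\<lambda>x. d x * M"])
      show "AE x in lebesgue_on \<Omega>. (\<lambda>k. \<eta> k x * (grad \<psi> x \<bullet> i)) \<longlonglongrightarrow> u x * (grad \<psi> x \<bullet> i)"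
        using lim(1) by eventually_elim (intro tendsto_intros)
      show "AE x in lebesgue_on \<Omega>. norm (\<eta> k x * (grad \<psi> x \<bullet> i)) \<le> d x * M" for k
        using bound(1)[of k]
      proof eventually_elim
        case (elim x)
        have "\<bar>grad \<psi> x \<bullet> i\<bar> \<le> M"
          using Basis_le_norm[OF i, of "grad \<psi> x"] M(2)[of x] by linarith
        with elim show ?case
          unfolding real_norm_def abs_mult by (intro mult_mono) auto
      qed
    qed (use meas meas_\<psi>[THEN borel_measurable_lebesgue_onI] d1 in \<open>auto intro!: borel_measurable_times\<close>)
    then have "(\<lambda>k. - (LINT x|lebesgue_on \<Omega>. (grad (\<eta> k) x \<bullet> i) * \<psi> x)) \<longlonglongrightarrow> (LINT x|lebesgue_on \<Omega>. u x * (grad \<psi> x \<bullet> i))"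
      by (simp only: parts)
    moreover have "(\<lambda>k. LINT x|lebesgue_on \<Omega>. (grad (\<eta> k) x \<bullet> i) * \<psi> x) \<longlonglongrightarrow> (LINT x|lebesgue_on \<Omega>. (Du x \<bullet> i) * \<psi> x)"
    proof (rule integral_dominated_convergence[where w = "\<lambda>x. d x * M"])
      show "AE x in lebesgue_on \<Omega>. (\<lambda>k. (grad (\<eta> k) x \<bullet> i) * \<psi> x) \<longlonglongrightarrow> (Du x \<bullet> i) * \<psi> x"
        using lim(2) by eventually_elim (intro tendsto_intros)
      show "AE x in lebesgue_on \<Omega>. norm ((grad (\<eta> k) x \<bullet> i) * \<psi> x) \<le> d x * M" for k
        using bound(2)[of k]
      proof eventually_elim
        case (elim x)
        have "\<bar>grad (\<eta> k) x \<bullet> i\<bar> \<le> d x"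
          using Basis_le_norm[OF i, of "grad (\<eta> k) x"] elim by linarith
        with M(1)[of x] show ?case
          unfolding real_norm_def abs_mult by (intro mult_mono) auto
      qed
    qed (use meas meas_\<psi>[THEN borel_measurable_lebesgue_onI] d1 in \<open>auto intro!: borel_measurable_times borel_measurable_inner\<close>)
    ultimately show ?thesis
      by (rule LIMSEQ_unique[OF _ tendsto_minus])
  qed
  with L2_u L2_Du test show ?thesis
    unfolding W0_1_2_def W_1_2_def by blast
qed

section \<open>A smooth substitute for the positive part\<close>

text \<open>A smooth substitute for the positive part. Its rescalings \<open>z \<mapsto> flat_ramp (N z - 1) / N\<close>
vanish for \<open>z \<le> 1 / N\<close>, lie below the positive part and have slope at most \<open>1\<close>; for \<open>z > 0\<close> they
converge to \<open>z\<close> and their slopes to \<open>1\<close>. Composed with a function vanishing on the boundary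
they produce compact support.\<close>

definition flat_ramp :: "real \<Rightarrow> real" where
  "flat_ramp z = z * flat 0 z"

definition flat_ramp' :: "real \<Rightarrow> real" where
  "flat_ramp' z = flat 0 z + z * flat 2 z"

lemma flat_ramp_has_derivative: "(flat_ramp has_real_derivative flat_ramp' z) (at z)"
  unfolding flat_ramp_def[abs_def] flat_ramp'_def
  using flat_has_derivative[of 0 z] by (auto intro!: derivative_eq_intros simp: numeral_2_eq_2)

lemma flat_ramp_bounds: "0 \<le> flat_ramp z" "flat_ramp z \<le> max 0 z"
  by (auto simp: flat_ramp_def flat_def mult_le_cancel_left1)

lemma flat_ramp'_bounds: "0 \<le> flat_ramp' z" "flat_ramp' z \<le> 1"
proof -
  have "(1 + 1 / z) * exp (- (1 / z)) \<le> exp (1 / z) * exp (- (1 / z))" if "0 < z"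
    by (intro mult_right_mono exp_ge_add_one_self) simp
  then show "0 \<le> flat_ramp' z" "flat_ramp' z \<le> 1"
    by (auto simp: flat_ramp'_def flat_def exp_add[symmetric] power2_eq_square algebra_simps)
qed

lemma flat_at_top: "(flat m \<longlongrightarrow> (if m = 0 then 1 else 0)) at_top"
proof -
  have "((\<lambda>t::real. exp (- inverse t) * inverse t ^ m) \<longlongrightarrow> exp (- 0) * 0 ^ m) at_top"
    by (intro tendsto_intros tendsto_inverse_0_at_top filterlim_ident)
  moreover have "\<forall>\<^sub>F t in at_top. exp (- inverse t) * inverse t ^ m = flat m t"
    using eventually_gt_at_top[of 0] by eventually_elim (simp add: flat_def field_simps)
  ultimately have "(flat m \<longlongrightarrow> exp (- 0) * 0 ^ m) at_top"
    by (rule Lim_transform_eventually)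
  then show ?thesis
    by (cases m) simp_all
qed

lemma flat_ramp_rescaled_limits:
  assumes "0 < h"
  shows "(\<lambda>k. flat_ramp (real (Suc k) * h - 1) / real (Suc k)) \<longlonglongrightarrow> h"
    and "(\<lambda>k. flat_ramp' (real (Suc k) * h - 1)) \<longlonglongrightarrow> 1"
proof -
  have "filterlim (\<lambda>k. - 1 + real (Suc k) * h) at_top sequentially"
    using assms
    by (intro filterlim_tendsto_add_at_top[OF tendsto_const]
        filterlim_at_top_mult_tendsto_pos[OF tendsto_const]
        filterlim_compose[OF filterlim_real_sequentially filterlim_Suc])
  then have top: "filterlim (\<lambda>k. real (Suc k) * h - 1) at_top sequentially"
    by simp
  note flat = filterlim_compose[OF flat_at_top top]
  have "(\<lambda>k. (h - 1 / real (Suc k)) * flat 0 (real (Suc k) * h - 1)) \<longlonglongrightarrow> (h - 0) * (if (0::nat) = 0 then 1 else 0)"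
    using LIMSEQ_inverse_real_of_nat
    by (intro tendsto_mult tendsto_diff tendsto_const flat) (simp add: inverse_eq_divide)
  moreover have "(h - 1 / real (Suc k)) * flat 0 (real (Suc k) * h - 1) = flat_ramp (real (Suc k) * h - 1) / real (Suc k)" for k
    by (simp add: flat_ramp_def field_simps)
  ultimately show "(\<lambda>k. flat_ramp (real (Suc k) * h - 1) / real (Suc k)) \<longlonglongrightarrow> h"
    by simp
  have "z * flat 2 z = flat 1 z" for z
    by (simp add: flat_def power2_eq_square)
  then show "(\<lambda>k. flat_ramp' (real (Suc k) * h - 1)) \<longlonglongrightarrow> 1"
    using tendsto_add[OF flat[of 0] flat[of 1]] by (simp add: flat_ramp'_def)
qed

section \<open>Regularity of the logarithm times powers\<close>

text \<open>Used for \<open>r = \<bar>x\<bar>\<close>: the regularised logarithms \<open>ln (\<bar>x\<bar>\<^sup>2 + e)\<close> share the majorant \<open>2 / \<bar>x\<bar>\<close>.\<close>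

lemma abs_ln_le:
  assumes "0 < r" "r < 1" "0 \<le> e" "e \<le> (1::real)"
  shows "\<bar>ln (r\<^sup>2 + e)\<bar> \<le> 2 / r"
proof -
  have "0 < r\<^sup>2" "r\<^sup>2 < 1"
    using assms by (auto simp: power_less_one_iff)
  have "ln (r\<^sup>2 + e) \<le> r\<^sup>2 + e - 1"
    using \<open>0 < r\<^sup>2\<close> assms by (intro ln_le_minus_one) linarith
  also have "\<dots> \<le> 1"
    using \<open>r\<^sup>2 < 1\<close> assms by simp
  also have "1 \<le> 2 / r"
    using assms by simp
  finally have "ln (r\<^sup>2 + e) \<le> 2 / r" .
  moreover have "- ln (r\<^sup>2 + e) \<le> 2 / r"
  proof -
    have "- ln (r\<^sup>2 + e) \<le> - ln (r\<^sup>2)"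
      using \<open>0 < r\<^sup>2\<close> assms by (intro le_imp_neg_le ln_le_cancel_iff[THEN iffD2]) linarith+
    also have "\<dots> = 2 * ln (1 / r)"
      using assms by (simp add: ln_realpow ln_div)
    also have "\<dots> \<le> 2 * (1 / r - 1)"
      using assms by (intro mult_left_mono ln_le_minus_one) auto
    finally show ?thesis
      by simp
  qed
  ultimately show ?thesis
    by simp
qed

text \<open>Since \<open>ln\<close> is extended to negative arguments as an even function, the facts below hold on the
whole real line, and the chain rule can be used at the origin without one-sided derivatives.\<close>

lemma ln_abs: "ln \<bar>s\<bar> = ln s" for s :: real
  by (simp add: abs_if ln_minus)

lemma tendsto_mult_ln_0: "((\<lambda>s::real. s * ln s) \<longlongrightarrow> 0) (at 0)"
proof (rule Lim_null_comparison)
  show "((\<lambda>s. 2 * sqrt \<bar>s\<bar>) \<longlongrightarrow> 0) (at 0)"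
    by (auto intro!: tendsto_eq_intros)
  show "\<forall>\<^sub>F s in at 0. norm (s * ln s) \<le> 2 * sqrt \<bar>s\<bar>"
    unfolding eventually_at
  proof (intro exI[of _ 1] conjI ballI impI)
    fix s :: real assume s: "s \<noteq> 0 \<and> dist s 0 < 1"
    then have "\<bar>ln \<bar>s\<bar>\<bar> \<le> 2 / sqrt \<bar>s\<bar>"
      using abs_ln_le[of "sqrt \<bar>s\<bar>" 0] by (simp add: dist_real_def)
    then have "\<bar>s\<bar> * \<bar>ln \<bar>s\<bar>\<bar> \<le> \<bar>s\<bar> * (2 / sqrt \<bar>s\<bar>)"
      by (intro mult_left_mono) auto
    also have "\<dots> = 2 * sqrt \<bar>s\<bar>"
      using s real_sqrt_mult_self[of "\<bar>s\<bar>"] by (simp add: field_simps)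
    finally show "norm (s * ln s) \<le> 2 * sqrt \<bar>s\<bar>"
      by (simp add: abs_mult ln_abs)
  qed simp
qed

lemma continuous_on_mult_ln: "continuous_on UNIV (\<lambda>s::real. s * ln s)"
proof -
  have "isCont (\<lambda>s::real. s * ln s) s" for s
    using tendsto_mult_ln_0 by (cases "s = 0") (auto intro!: tendsto_intros simp: isCont_def)
  then show ?thesis
    by (simp add: continuous_at_imp_continuous_on)
qed

lemma square_mult_ln_has_derivative:
  "((\<lambda>s::real. s\<^sup>2 * ln s) has_real_derivative 2 * (s * ln s) + s) (at s)"
proof (cases "s = 0")
  case True
  have "((\<lambda>h::real. ((0 + h)\<^sup>2 * ln (0 + h) - 0\<^sup>2 * ln 0) / h) \<longlongrightarrow> 0) (at 0)"
    by (rule Lim_transform_eventually[OF tendsto_mult_ln_0])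
       (simp add: eventually_at_filter power2_eq_square)
  with True show ?thesis
    by (simp add: DERIV_def)
next
  case False
  have "((\<lambda>s. ln (- s)) has_real_derivative 1 / s) (at s)" if "s < 0"
    using that by (auto intro!: derivative_eq_intros)
  with False have "(ln has_real_derivative 1 / s) (at s)"
    using DERIV_ln_divide[of s] by (cases "s < 0") (simp_all add: ln_minus)
  then have "((\<lambda>s::real. s\<^sup>2 * ln s) has_real_derivative (2 * s) * ln s + 1 / s * s\<^sup>2) (at s)"
    by (intro DERIV_mult) (auto intro!: derivative_eq_intros)
  then show ?thesis
    by (rule DERIV_cong) (use False in \<open>simp add: power2_eq_square\<close>)
qed

section \<open>The singular function and its approximation\<close>

text \<open>This is \<open>- ln \<bar>x\<bar> * (e\<^sup>-\<^sup>6 - \<bar>x\<bar>\<^sup>6)\<close>. The second factor vanishes on the boundary of the ball of radius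
\<open>1 / e\<close>; the logarithm is written in terms of \<open>x \<bullet> x = \<bar>x\<bar>\<^sup>2\<close> which is smooth
also at the origin, so that the chain rule yields the gradients of radial functions there.\<close>

definition singular_solution :: "'a::euclidean_space \<Rightarrow> real" where
  "singular_solution x = - (1 / 2) * ln (x \<bullet> x) * (exp (- 6) - (x \<bullet> x) ^ 3)"

definition singular_solution_grad :: "'a::euclidean_space \<Rightarrow> 'a" where
  "singular_solution_grad x =
     (3 * ((x \<bullet> x)\<^sup>2 * ln (x \<bullet> x)) - (exp (- 6) - (x \<bullet> x) ^ 3) / (x \<bullet> x)) *\<^sub>R x"

text \<open>The negative divergence of the field \<open>m (x \<bullet> x) *\<^sub>R x\<close> with \<open>m s = 3 * (s\<^sup>2 * ln s)\<close>, that is,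
\<open>- (n * m (x \<bullet> x) + 2 * (x \<bullet> x) * m' (x \<bullet> x))\<close>.\<close>

definition singular_source :: "'a::euclidean_space \<Rightarrow> real" where
  "singular_source x = - (real DIM('a) * (3 * ((x \<bullet> x)\<^sup>2 * ln (x \<bullet> x)))
     + 2 * (x \<bullet> x) * (3 * (2 * ((x \<bullet> x) * ln (x \<bullet> x)) + x \<bullet> x)))"

text \<open>The radial profile of the singular solution with \<open>ln s\<close> replaced by \<open>ln (s + 1 / (k + 1))\<close>, which is
smooth at the origin, and with \<open>e\<^sup>-\<^sup>6 - s\<^sup>3\<close> truncated smoothly near the boundary.\<close>

definition approx_profile :: "nat \<Rightarrow> real \<Rightarrow> real" where
  "approx_profile k s = - (1 / 2) * ln (s + 1 / real (Suc k)) *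
     (flat_ramp (real (Suc k) * (exp (- 6) - s ^ 3) - 1) / real (Suc k))"

definition approx_profile' :: "nat \<Rightarrow> real \<Rightarrow> real" where
  "approx_profile' k s =
     - (1 / 2) * (1 / (s + 1 / real (Suc k))) * (flat_ramp (real (Suc k) * (exp (- 6) - s ^ 3) - 1) / real (Suc k))
     + 3 / 2 * s\<^sup>2 * ln (s + 1 / real (Suc k)) * flat_ramp' (real (Suc k) * (exp (- 6) - s ^ 3) - 1)"

lemma approx_profile_has_derivative:
  assumes "0 \<le> s"
  shows "(approx_profile k has_real_derivative approx_profile' k s) (at s)"
proof -
  define N where "N = real (Suc k)"
  have "0 < N"
    by (simp add: N_def)
  then have "0 < s + 1 / N"
    using assms by (intro add_nonneg_pos) auto
  then have ln: "((\<lambda>s. ln (s + 1 / N)) has_real_derivative 1 / (s + 1 / N)) (at s)"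
    by (auto intro!: derivative_eq_intros)
  have "((\<lambda>s. N * (exp (- 6) - s ^ 3) - 1) has_real_derivative N * (- 3 * s\<^sup>2)) (at s)"
    by (auto intro!: derivative_eq_intros)
  from DERIV_chain2[OF flat_ramp_has_derivative this]
  have ramp: "((\<lambda>s. flat_ramp (N * (exp (- 6) - s ^ 3) - 1) / N) has_real_derivative
      flat_ramp' (N * (exp (- 6) - s ^ 3) - 1) * (N * (- 3 * s\<^sup>2)) / N) (at s)"
    by (rule DERIV_cdivide)
  have "((\<lambda>s. - (1 / 2) * ln (s + 1 / N) * (flat_ramp (N * (exp (- 6) - s ^ 3) - 1) / N)) has_real_derivative
      - (1 / 2) * (1 / (s + 1 / N)) * (flat_ramp (N * (exp (- 6) - s ^ 3) - 1) / N)
      + 3 / 2 * s\<^sup>2 * ln (s + 1 / N) * flat_ramp' (N * (exp (- 6) - s ^ 3) - 1)) (at s)"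
    using DERIV_mult[OF DERIV_cmult[OF ln, of "- (1 / 2)"] ramp]
    by (rule DERIV_cong) (use \<open>0 < N\<close> in \<open>simp add: algebra_simps\<close>)
  then show ?thesis
    unfolding approx_profile_def[abs_def] approx_profile'_def N_def .
qed

lemma GDERIV_radial:
  assumes "(f has_real_derivative f') (at (x \<bullet> x))"
  shows "GDERIV (\<lambda>x. f (x \<bullet> x)) x :> (2 * f') *\<^sub>R x"
proof -
  have "GDERIV (\<lambda>x. x \<bullet> x) x :> 2 *\<^sub>R x"
    by (auto simp: gderiv_def inner_commute intro!: derivative_eq_intros)
  from GDERIV_DERIV_compose[OF this assms] show ?thesis
    by (simp add: mult.commute)
qed

lemma GDERIV_approx: "GDERIV (\<lambda>x. approx_profile k (x \<bullet> x)) x :> (2 * approx_profile' k (x \<bullet> x)) *\<^sub>R x"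
  by (intro GDERIV_radial approx_profile_has_derivative) simp

lemma explicitly_smooth_approx: "explicitly_smooth (\<lambda>x::'a::euclidean_space. approx_profile k (x \<bullet> x))"
proof -
  define N where "N = real (Suc k)"
  \<comment> \<open>The argument of \<open>flat_ramp\<close>, spelled with the constructors of \<open>explicitly_smooth\<close> only.\<close>
  define z where "z x = N * (exp (- 6) + (- 1) * ((x \<bullet> x) * ((x \<bullet> x) * (x \<bullet> x)))) + (- 1)" for x :: 'a
  have "explicitly_smooth z"
    unfolding z_def[abs_def] by (intro explicitly_smooth.intros)
  moreover have "0 < x \<bullet> x + 1 / N" for x :: 'a
    by (intro add_nonneg_pos) (auto simp: N_def)
  ultimately have "explicitly_smooth (\<lambda>x::'a. (- (1 / 2) * ln (x \<bullet> x + 1 / N)) * (z x * flat 0 (z x) * (1 / N)))"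
    by (intro explicitly_smooth.intros)
  then show ?thesis
    by (simp add: approx_profile_def flat_ramp_def z_def N_def power3_eq_cube mult.assoc)
qed

lemma inner_self_in_ball:
  assumes "x \<in> ball 0 (1 / exp 1)"
  shows "norm x < 1" and "x \<bullet> x < exp (- 2)" and "(x \<bullet> x) ^ 3 < exp (- 6)"
proof -
  have "1 / exp 1 < (1::real)"
    by simp
  moreover have "norm x < 1 / exp 1"
    using assms by simp
  ultimately show "norm x < 1"
    by linarith
  have "(norm x)\<^sup>2 < (exp (- 1))\<^sup>2"
    using assms by (intro power_strict_mono) (auto simp: exp_minus inverse_eq_divide)
  also have "(exp (- 1))\<^sup>2 = exp (- 2 :: real)"
    by (simp add: exp_of_nat_mult[symmetric])
  finally show "x \<bullet> x < exp (- 2)"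
    by (simp add: power2_norm_eq_inner)
  then have "(x \<bullet> x) ^ 3 < exp (- 2) ^ 3"
    by (intro power_strict_mono) auto
  then show "(x \<bullet> x) ^ 3 < exp (- 6)"
    by (simp add: exp_of_nat_mult[symmetric])
qed

lemma approx_test_function:
  "(\<lambda>x::'a::euclidean_space. approx_profile k (x \<bullet> x)) \<in> test_functions (ball 0 (1 / exp 1))"
proof -
  define N where "N = real (Suc k)"
  define K :: "'a set" where "K = {x. N * (exp (- 6) - (x \<bullet> x) ^ 3) - 1 \<ge> 0}"
  have "K \<subseteq> ball 0 (1 / exp 1)"
  proof
    fix x assume "x \<in> K"
    then have "0 < N * (exp (- 6) - (x \<bullet> x) ^ 3)"
      by (simp add: K_def)
    then have "((norm x)\<^sup>2) ^ 3 < exp (- 6)"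
      by (simp add: N_def zero_less_mult_iff power2_norm_eq_inner)
    then have "(norm x) ^ 6 < exp (- 1) ^ 6"
      by (simp add: exp_of_nat_mult[symmetric])
    then have "norm x < exp (- 1)"
      by (rule power_less_imp_less_base) simp
    then show "x \<in> ball 0 (1 / exp 1)"
      by (simp add: exp_minus inverse_eq_divide)
  qed
  moreover have "closed K"
    unfolding K_def by (intro closed_Collect_le continuous_intros)
  moreover have "{x::'a. approx_profile k (x \<bullet> x) \<noteq> 0} \<subseteq> K"
    by (auto simp: approx_profile_def flat_ramp_def flat_def K_def N_def split: if_splits)
  ultimately have "closure {x::'a. approx_profile k (x \<bullet> x) \<noteq> 0} \<subseteq> K" "K \<subseteq> ball 0 (1 / exp 1)"
    using closure_minimal by blast+
  then show ?thesis
    using explicitly_smooth_C_k[OF explicitly_smooth_approx]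
    by (auto simp: test_functions_def compact_closure intro: bounded_subset[OF bounded_ball] dest: subset_trans[OF closure_subset])
qed

text \<open>The logarithm and its derivative contribute the singularity \<open>1 / \<bar>x\<bar>\<close>; the truncation contributes only
bounded factors because its value is at most \<open>1\<close> and its slope at most \<open>1\<close>.\<close>

lemma approx_profile_bounds:
  assumes "x \<in> ball 0 (1 / exp 1)" and "x \<noteq> 0"
  shows "\<bar>approx_profile k (x \<bullet> x)\<bar> \<le> 7 / norm x"
    and "norm ((2 * approx_profile' k (x \<bullet> x)) *\<^sub>R x) \<le> 7 / norm x"
proof -
  define r where "r = norm x"
  define N where "N = real (Suc k)"
  define s where "s = x \<bullet> x"
  define R where "R = flat_ramp (N * (exp (- 6) - s ^ 3) - 1) / N"
  define R' where "R' = flat_ramp' (N * (exp (- 6) - s ^ 3) - 1)"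
  define l where "l = ln (s + 1 / N)"
  have N: "1 \<le> N"
    by (simp add: N_def)
  have s: "s = r\<^sup>2" "0 < s"
    using assms(2) by (simp_all add: s_def r_def power2_norm_eq_inner)
  have r: "0 < r" "r < 1"
    using assms(2) inner_self_in_ball(1)[OF assms(1)] by (simp_all add: r_def)
  have h: "s ^ 3 < exp (- 6)"
    using inner_self_in_ball[OF assms(1)] by (simp add: s_def)
  have "s \<le> 1"
    using r by (simp add: s power_le_one)
  have l: "\<bar>l\<bar> \<le> 2 / r"
    unfolding l_def s using r N by (intro abs_ln_le) auto
  have R: "0 \<le> R" "R \<le> 1"
  proof -
    show "0 \<le> R"
      using N by (simp add: R_def flat_ramp_bounds)
    have "0 \<le> N * (exp (- 6) - s ^ 3)"
      using h N by simp
    then have "flat_ramp (N * (exp (- 6) - s ^ 3) - 1) \<le> N * (exp (- 6) - s ^ 3)"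
      using flat_ramp_bounds(2)[of "N * (exp (- 6) - s ^ 3) - 1"] by linarith
    also have "\<dots> \<le> N * 1"
    proof -
      have "exp (- 6) \<le> (1::real)" "0 \<le> s ^ 3"
        using s by simp_all
      then have "exp (- 6) - s ^ 3 \<le> 1"
        by linarith
      with N show ?thesis
        by (intro mult_left_mono) auto
    qed
    finally show "R \<le> 1"
      using N by (simp add: R_def field_simps)
  qed
  have R': "0 \<le> R'" "R' \<le> 1"
    by (simp_all add: R'_def flat_ramp'_bounds)
  have "\<bar>l\<bar> * R \<le> 2 / r * 1"
    using l R r by (intro mult_mono) auto
  moreover have "approx_profile k (x \<bullet> x) = - (1 / 2) * (l * R)"
    by (simp add: approx_profile_def l_def R_def s_def N_def)
  ultimately have "\<bar>approx_profile k (x \<bullet> x)\<bar> \<le> 1 / r"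
    using R by (simp add: abs_mult)
  also have "\<dots> \<le> 7 / r"
    using r by (simp add: divide_right_mono)
  finally show "\<bar>approx_profile k (x \<bullet> x)\<bar> \<le> 7 / norm x"
    by (simp add: r_def)
  have "1 / (s + 1 / N) * R \<le> 1 / s * 1"
    using s N R by (intro mult_mono divide_left_mono) (auto intro!: mult_pos_pos add_pos_pos)
  moreover have "s\<^sup>2 * \<bar>l\<bar> * R' \<le> 1 * (2 / r) * 1"
    using s \<open>s \<le> 1\<close> l R' r by (intro mult_mono) (auto simp: power_le_one)
  ultimately have "\<bar>2 * approx_profile' k s\<bar> \<le> 1 / s + 6 / r"
  proof -
    have "2 * approx_profile' k s = - (1 / (s + 1 / N) * R) + 3 * (s\<^sup>2 * l * R')"
    proof -
      have "2 * (- (1 / 2) * a * R + 3 / 2 * s\<^sup>2 * l * R') = - (a * R) + 3 * (s\<^sup>2 * l * R')" for a :: real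
        by (simp add: algebra_simps)
      then show ?thesis
        unfolding approx_profile'_def N_def[symmetric] R_def[symmetric] R'_def[symmetric] l_def[symmetric] .
    qed
    moreover have "0 \<le> 1 / (s + 1 / N) * R"
      using s N R by (intro mult_nonneg_nonneg) (auto intro: add_nonneg_nonneg)
    moreover have "\<bar>s\<^sup>2 * l * R'\<bar> = s\<^sup>2 * \<bar>l\<bar> * R'"
      using R' by (simp add: abs_mult)
    ultimately show ?thesis
      using \<open>1 / (s + 1 / N) * R \<le> 1 / s * 1\<close> \<open>s\<^sup>2 * \<bar>l\<bar> * R' \<le> 1 * (2 / r) * 1\<close> by (auto simp: abs_if split: if_splits)
  qed
  then have "norm ((2 * approx_profile' k (x \<bullet> x)) *\<^sub>R x) \<le> (1 / s + 6 / r) * r"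
    using r unfolding norm_scaleR by (auto simp: s_def[symmetric] r_def[symmetric] intro!: mult_right_mono)
  also have "\<dots> = 1 / r + 6"
    using r by (simp add: s power2_eq_square field_simps)
  also have "\<dots> \<le> 7 / r"
    using r by (simp add: field_simps)
  finally show "norm ((2 * approx_profile' k (x \<bullet> x)) *\<^sub>R x) \<le> 7 / norm x"
    by (simp add: r_def)
qed

lemma approx_profile_limits:
  assumes "x \<in> ball 0 (1 / exp 1)" and "x \<noteq> 0"
  shows "(\<lambda>k. approx_profile k (x \<bullet> x)) \<longlonglongrightarrow> singular_solution x"
    and "(\<lambda>k. (2 * approx_profile' k (x \<bullet> x)) *\<^sub>R x) \<longlonglongrightarrow> singular_solution_grad x"
proof -
  define s where "s = x \<bullet> x"
  define h where "h = exp (- 6) - s ^ 3"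
  have "0 < s"
    using assms(2) by (simp add: s_def)
  have "0 < h"
    using inner_self_in_ball[OF assms(1)] by (simp add: s_def h_def)
  note R = flat_ramp_rescaled_limits[OF this]
  have "(\<lambda>k. s + 1 / real (Suc k)) \<longlonglongrightarrow> s + 0"
    using LIMSEQ_inverse_real_of_nat by (intro tendsto_intros) (simp add: inverse_eq_divide)
  then have e: "(\<lambda>k. s + 1 / real (Suc k)) \<longlonglongrightarrow> s"
    by simp
  have "(\<lambda>k. approx_profile k s) \<longlonglongrightarrow> - (1 / 2) * ln s * h"
    unfolding approx_profile_def h_def[symmetric]
    using \<open>0 < s\<close> by (intro tendsto_intros e R) auto
  then show "(\<lambda>k. approx_profile k (x \<bullet> x)) \<longlonglongrightarrow> singular_solution x"
    by (simp add: singular_solution_def s_def h_def)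
  have "(\<lambda>k. approx_profile' k s) \<longlonglongrightarrow> - (1 / 2) * (1 / s) * h + 3 / 2 * s\<^sup>2 * ln s * 1"
    unfolding approx_profile'_def h_def[symmetric]
    using \<open>0 < s\<close> by (intro tendsto_intros e R) auto
  then have "(\<lambda>k. (2 * approx_profile' k s) *\<^sub>R x) \<longlonglongrightarrow> (2 * (- (1 / 2) * (1 / s) * h + 3 / 2 * s\<^sup>2 * ln s * 1)) *\<^sub>R x"
    by (intro tendsto_intros)
  also have "2 * (- (1 / 2) * (1 / s) * h + 3 / 2 * s\<^sup>2 * ln s * 1) = 3 * (s\<^sup>2 * ln s) - h / s"
    by (simp add: algebra_simps)
  finally show "(\<lambda>k. (2 * approx_profile' k (x \<bullet> x)) *\<^sub>R x) \<longlonglongrightarrow> singular_solution_grad x"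
    by (simp add: singular_solution_grad_def s_def h_def)
qed

text \<open>The formulas for the singular solution and its approximants are only compared away from the origin.\<close>

lemma AE_lebesgue_on_nonzeroI:
  assumes "\<And>x. x \<in> S \<Longrightarrow> x \<noteq> 0 \<Longrightarrow> P x" and "S \<in> sets lebesgue"
  shows "AE x in lebesgue_on S. P (x::'a::euclidean_space)"
proof -
  have "AE x in lebesgue. x \<noteq> (0::'a)"
    by (rule AE_completion) (rule AE_lborel_singleton)
  then show ?thesis
    using assms by (subst AE_restrict_space_iff) (auto elim: eventually_mono)
qed

text \<open>The majorant \<open>7 / \<bar>x\<bar>\<close> is square integrable because the dimension is at least \<open>3\<close>.\<close>

lemma singular_solution_W0_1_2:
  assumes "3 \<le> DIM('a)"
  shows "W0_1_2 (ball 0 (1 / exp 1)) (singular_solution :: 'a::euclidean_space \<Rightarrow> real) singular_solution_grad"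
proof (rule W0_1_2_dominated_limit)
  have dim: "1 < real DIM('a)" "2 < real DIM('a)"
    using assms by simp_all
  have d: "7 / norm x = 7 * norm (x - 0) powr - 1" "(7 / norm x)\<^sup>2 = 49 * norm (x - 0) powr - 2" for x :: 'a
    by (simp_all add: powr_minus_divide power_divide)
  show "integrable (lebesgue_on (ball 0 (1 / exp 1))) (\<lambda>x::'a. 7 / norm x)"
    unfolding d(1) using norm_powr_integral_bound[OF _ dim(1)] by (intro integrable_mult_right) (metis zero_less_one)
  show "integrable (lebesgue_on (ball 0 (1 / exp 1))) (\<lambda>x::'a. (7 / norm x)\<^sup>2)"
    unfolding d(2) using norm_powr_integral_bound[OF _ dim(2)] by (intro integrable_mult_right) (metis zero_less_numeral)
next
  fix k
  show "(\<lambda>x::'a. approx_profile k (x \<bullet> x)) \<in> test_functions (ball 0 (1 / exp 1))"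
    by (rule approx_test_function)
  show "AE x::'a in lebesgue_on (ball 0 (1 / exp 1)). \<bar>approx_profile k (x \<bullet> x)\<bar> \<le> 7 / norm x"
    by (rule AE_lebesgue_on_nonzeroI) (auto intro!: approx_profile_bounds)
  show "AE x::'a in lebesgue_on (ball 0 (1 / exp 1)). norm (grad (\<lambda>x. approx_profile k (x \<bullet> x)) x) \<le> 7 / norm x"
    unfolding GDERIV_approx[THEN grad_eq]
    by (rule AE_lebesgue_on_nonzeroI) (auto intro!: approx_profile_bounds simp del: norm_scaleR)
next
  show "AE x::'a in lebesgue_on (ball 0 (1 / exp 1)). (\<lambda>k. approx_profile k (x \<bullet> x)) \<longlonglongrightarrow> singular_solution x"
    by (rule AE_lebesgue_on_nonzeroI) (auto intro!: approx_profile_limits)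
  show "AE x::'a in lebesgue_on (ball 0 (1 / exp 1)).
      (\<lambda>k. grad (\<lambda>x. approx_profile k (x \<bullet> x)) x) \<longlonglongrightarrow> singular_solution_grad x"
    unfolding GDERIV_approx[THEN grad_eq]
    by (rule AE_lebesgue_on_nonzeroI) (auto intro!: approx_profile_limits)
  show "(singular_solution :: 'a \<Rightarrow> real) \<in> borel_measurable borel"
    unfolding singular_solution_def by measurable
  show "(singular_solution_grad :: 'a \<Rightarrow> 'a) \<in> borel_measurable borel"
    unfolding singular_solution_grad_def by measurable
qed simp

section \<open>The singular function solves the adjoint problem\<close>

lemma integrable_on_ball_continuous:
  fixes f :: "'a::euclidean_space \<Rightarrow> real"
  assumes "continuous_on UNIV f"
  shows "integrable (lebesgue_on (ball c r)) f"
proof -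
  interpret finite_measure "lebesgue_on (ball c r)"
    by (rule finite_measure_lebesgue_on_ball)
  have "bounded (f ` cball c r)"
    by (intro compact_imp_bounded compact_continuous_image continuous_on_subset[OF assms]) auto
  then obtain M where "\<forall>x\<in>cball c r. norm (f x) \<le> M"
    unfolding bounded_iff by auto
  then show ?thesis
    using borel_measurable_continuous_onI[OF assms]
    by (intro integrable_const_bound[where B = M] borel_measurable_lebesgue_onI) auto
qed

lemma integration_by_parts_field:
  fixes F :: "'a::euclidean_space \<Rightarrow> 'a"
  assumes \<psi>: "\<psi> \<in> test_functions (ball c r)"
    and F: "\<And>i x. i \<in> Basis \<Longrightarrow> GDERIV (\<lambda>x. F x \<bullet> i) x :> D i x"
    and D: "\<And>i. i \<in> Basis \<Longrightarrow> continuous_on UNIV (\<lambda>x. D i x \<bullet> i)"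
  shows "(LINT x|lebesgue_on (ball c r). F x \<bullet> grad \<psi> x) =
    - (LINT x|lebesgue_on (ball c r). (\<Sum>i\<in>Basis. D i x \<bullet> i) * \<psi> x)"
proof -
  note g = test_function_gradient[OF \<psi>]
  have int: "integrable (lebesgue_on (ball c r)) (\<lambda>x. (F x \<bullet> i) * (grad \<psi> x \<bullet> i))"
    "integrable (lebesgue_on (ball c r)) (\<lambda>x. (D i x \<bullet> i) * \<psi> x)" if "i \<in> Basis" for i
  proof -
    have "continuous_on UNIV (\<lambda>x. grad \<psi> x \<bullet> i)"
      using g(2) by (intro continuous_intros)
    with GDERIV_continuous_on[OF F[OF that]] D[OF that] g(3)
    show "integrable (lebesgue_on (ball c r)) (\<lambda>x. (F x \<bullet> i) * (grad \<psi> x \<bullet> i))"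
      "integrable (lebesgue_on (ball c r)) (\<lambda>x. (D i x \<bullet> i) * \<psi> x)"
      by (simp_all add: integrable_on_ball_continuous continuous_on_mult)
  qed
  have inner: "F x \<bullet> grad \<psi> x = (\<Sum>i\<in>Basis. (F x \<bullet> i) * (grad \<psi> x \<bullet> i))" for x
    by (rule euclidean_inner)
  have "(LINT x|lebesgue_on (ball c r). F x \<bullet> grad \<psi> x) =
      (\<Sum>i\<in>Basis. LINT x|lebesgue_on (ball c r). (F x \<bullet> i) * (grad \<psi> x \<bullet> i))"
    using int by (simp add: inner)
  also have "\<dots> = (\<Sum>i\<in>Basis. - (LINT x|lebesgue_on (ball c r). (D i x \<bullet> i) * \<psi> x))"
    by (intro sum.cong refl integration_by_parts \<psi> F D) auto
  also have "\<dots> = - (LINT x|lebesgue_on (ball c r). (\<Sum>i\<in>Basis. D i x \<bullet> i) * \<psi> x)"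
    using int by (simp add: sum_negf sum_distrib_right)
  finally show ?thesis .
qed

text \<open>Every logarithm in the source comes with a factor \<open>x \<bullet> x\<close> that cancels its singularity; this is the
gain from the power \<open>6\<close> in the singular solution.\<close>

lemma continuous_singular_source: "continuous_on UNIV (singular_source :: 'a::euclidean_space \<Rightarrow> real)"
proof -
  have cont: "continuous_on UNIV (\<lambda>x::'a. (x \<bullet> x) * ln (x \<bullet> x))"
    by (rule continuous_on_compose2[OF continuous_on_mult_ln]) (auto intro!: continuous_intros)
  have eq: "(x \<bullet> x)\<^sup>2 * ln (x \<bullet> x) = (x \<bullet> x) * ((x \<bullet> x) * ln (x \<bullet> x))" for x :: 'a
    by (simp add: power2_eq_square)
  show ?thesis
    unfolding singular_source_def eq by (intro continuous_intros cont)
qed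

text \<open>Away from the origin the drift is minus the gradient of \<open>ln \<bar>ln \<bar>x\<bar>\<bar>\<close>. Therefore \<open>\<nabla>u + u b = - ln \<bar>x\<bar> \<nabla>w\<close> whenever
\<open>u = - ln \<bar>x\<bar> * w\<close>: the terms of size \<open>1 / \<bar>x\<bar>\<close> cancel.\<close>

lemma singular_solution_flux:
  assumes "x \<in> ball 0 (1 / exp 1)" and "x \<noteq> 0"
  shows "singular_solution_grad x + singular_solution x *\<^sub>R log_drift x = (3 * ((x \<bullet> x)\<^sup>2 * ln (x \<bullet> x))) *\<^sub>R x"
proof -
  have "ln (norm x) \<noteq> 0"
    using assms(2) inner_self_in_ball(1)[OF assms(1)] by simp
  moreover have "ln (x \<bullet> x) = 2 * ln (norm x)"
    using assms(2) by (simp add: power2_norm_eq_inner[symmetric] ln_realpow)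
  ultimately have "singular_solution x * - (1 / ((norm x)\<^sup>2 * ln (norm x))) = (exp (- 6) - (x \<bullet> x) ^ 3) / (x \<bullet> x)"
    using assms(2) by (simp add: singular_solution_def power2_norm_eq_inner)
  then show ?thesis
    unfolding log_drift_def singular_solution_grad_def scaleR_scaleR scaleR_add_left[symmetric] by simp
qed

text \<open>By the cancellation in the flux, the weak formulation involves only a continuously differentiable
field, which can be integrated by parts directly.\<close>

lemma adjoint_weak_solution_singular:
  assumes "3 \<le> DIM('a)"
  shows "adjoint_weak_solution (ball 0 (1 / exp 1)) log_drift
    (singular_source :: 'a::euclidean_space \<Rightarrow> real) singular_solution"
  unfolding adjoint_weak_solution_def
proof (intro exI conjI ballI)
  show "W0_1_2 (ball 0 (1 / exp 1)) (singular_solution :: 'a \<Rightarrow> real) singular_solution_grad"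
    using assms by (rule singular_solution_W0_1_2)
next
  fix \<psi> :: "'a \<Rightarrow> real"
  assume \<psi>: "\<psi> \<in> test_functions (ball 0 (1 / exp 1))"
  define B :: "'a set" where "B = ball 0 (1 / exp 1)"
  define m where "m s = 3 * (s\<^sup>2 * ln s)" for s :: real
  define m' where "m' s = 3 * (2 * (s * ln s) + s)" for s :: real
  have m: "(m has_real_derivative m' s) (at s)" for s
    unfolding m_def[abs_def] m'_def by (intro DERIV_cmult square_mult_ln_has_derivative)
  define D where "D i x = m (x \<bullet> x) *\<^sub>R i + (x \<bullet> i) *\<^sub>R ((2 * m' (x \<bullet> x)) *\<^sub>R x)" for i x :: 'a
  have F: "GDERIV (\<lambda>x. (m (x \<bullet> x) *\<^sub>R x) \<bullet> i) x :> D i x" for i x :: 'a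
  proof -
    have "GDERIV (\<lambda>x. x \<bullet> i) x :> i"
      by (auto simp: gderiv_def intro!: derivative_eq_intros)
    from GDERIV_mult[OF GDERIV_radial[OF m] this] show ?thesis
      by (simp add: D_def)
  qed
  have m_cont: "continuous_on UNIV (\<lambda>x::'a. m (x \<bullet> x))"
    using GDERIV_radial[OF m] by (rule GDERIV_continuous_on)
  have "continuous_on UNIV m'"
    unfolding m'_def by (intro continuous_intros continuous_on_mult_ln)
  then have m'_cont: "continuous_on UNIV (\<lambda>x::'a. m' (x \<bullet> x))"
    by (rule continuous_on_compose2) (auto intro!: continuous_intros)
  have D: "continuous_on UNIV (\<lambda>x. D i x \<bullet> i)" for i
    unfolding D_def by (intro continuous_intros m_cont m'_cont)
  have div: "(\<Sum>i\<in>Basis. D i x \<bullet> i) = - singular_source x" for x :: 'a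
  proof -
    have "(\<Sum>i\<in>Basis. D i x \<bullet> i) = (\<Sum>i\<in>Basis. m (x \<bullet> x) + 2 * m' (x \<bullet> x) * ((x \<bullet> i) * (x \<bullet> i)))"
      by (intro sum.cong) (auto simp: D_def inner_add_left)
    also have "\<dots> = real DIM('a) * m (x \<bullet> x) + 2 * m' (x \<bullet> x) * (x \<bullet> x)"
      by (simp add: sum.distrib sum_distrib_left[symmetric] euclidean_inner[of x x, symmetric])
    finally show ?thesis
      by (simp add: singular_source_def m_def m'_def)
  qed
  have "(LINT x|lebesgue_on B. singular_solution_grad x \<bullet> grad \<psi> x + (log_drift x \<bullet> grad \<psi> x) * singular_solution x)
      = (LINT x|lebesgue_on B. (m (x \<bullet> x) *\<^sub>R x) \<bullet> grad \<psi> x)"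
  proof (rule Bochner_Integration.integral_cong_AE)
    have "(\<lambda>x. grad \<psi> x) \<in> borel_measurable borel"
      using test_function_gradient(2)[OF \<psi>] by (rule borel_measurable_continuous_onI)
    note [measurable] = this
    have "(log_drift :: 'a \<Rightarrow> 'a) \<in> borel_measurable borel" "(singular_solution :: 'a \<Rightarrow> real) \<in> borel_measurable borel"
      "(singular_solution_grad :: 'a \<Rightarrow> 'a) \<in> borel_measurable borel"
      unfolding log_drift_def singular_solution_grad_def singular_solution_def by measurable
    note [measurable] = this
    show "(\<lambda>x. singular_solution_grad x \<bullet> grad \<psi> x + (log_drift x \<bullet> grad \<psi> x) * singular_solution x)
        \<in> borel_measurable (lebesgue_on B)"
      by (intro borel_measurable_lebesgue_onI) measurable
    show "(\<lambda>x. (m (x \<bullet> x) *\<^sub>R x) \<bullet> grad \<psi> x) \<in> borel_measurable (lebesgue_on B)"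
      unfolding m_def by (intro borel_measurable_lebesgue_onI) measurable
    show "AE x in lebesgue_on B. singular_solution_grad x \<bullet> grad \<psi> x + (log_drift x \<bullet> grad \<psi> x) * singular_solution x
        = (m (x \<bullet> x) *\<^sub>R x) \<bullet> grad \<psi> x"
    proof (rule AE_lebesgue_on_nonzeroI)
      fix x assume "x \<in> B" "x \<noteq> 0"
      then have "m (x \<bullet> x) *\<^sub>R x = singular_solution_grad x + singular_solution x *\<^sub>R log_drift x"
        using singular_solution_flux[of x] by (simp add: m_def B_def)
      then show "singular_solution_grad x \<bullet> grad \<psi> x + (log_drift x \<bullet> grad \<psi> x) * singular_solution x
          = (m (x \<bullet> x) *\<^sub>R x) \<bullet> grad \<psi> x"
        by (simp only: inner_add_left inner_scaleR_left mult.commute)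
    qed (simp add: B_def)
  qed
  also have "\<dots> = - (LINT x|lebesgue_on B. (\<Sum>i\<in>Basis. D i x \<bullet> i) * \<psi> x)"
    unfolding B_def by (rule integration_by_parts_field[OF \<psi> F D])
  also have "\<dots> = (LINT x|lebesgue_on B. singular_source x * \<psi> x)"
    unfolding div by simp
  finally show "(LINT x|lebesgue_on (ball 0 (1 / exp 1)).
        singular_solution_grad x \<bullet> grad \<psi> x + (log_drift x \<bullet> grad \<psi> x) * singular_solution x)
      = (LINT x|lebesgue_on (ball 0 (1 / exp 1)). singular_source x * \<psi> x)"
    by (simp only: B_def)
qed

text \<open>In the ball \<open>ln (x \<bullet> x) < - 2\<close>, and the source equals \<open>- 3 * s\<^sup>2 * ((n + 4) * ln s + 2)\<close> for \<open>s = x \<bullet> x\<close>.\<close>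

lemma singular_source_nonneg:
  assumes "x \<in> ball 0 (1 / exp 1)"
  shows "0 \<le> singular_source x"
proof (cases "x = 0")
  case True
  then show ?thesis
    by (simp add: singular_source_def)
next
  case False
  define s where "s = x \<bullet> x"
  have "0 < s" "s < exp (- 2)"
    using False inner_self_in_ball[OF assms] by (simp_all add: s_def)
  then have "ln s < - 2"
    using ln_less_cancel_iff[of s "exp (- 2)"] by simp
  then have "(real DIM('a) + 4) * ln s \<le> (real DIM('a) + 4) * - 2"
    by (intro mult_left_mono) auto
  also have "\<dots> \<le> - 2"
    by simp
  finally have "0 \<le> 3 * s\<^sup>2 * - ((real DIM('a) + 4) * ln s + 2)"
    by (intro mult_nonneg_nonneg) auto
  also have "\<dots> = singular_source x"
    by (simp add: singular_source_def s_def algebra_simps power2_eq_square)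
  finally show ?thesis .
qed

lemma singular_source_bounded:
  obtains M where "\<And>x. x \<in> ball 0 (1 / exp 1) \<Longrightarrow> \<bar>singular_source (x::'a::euclidean_space)\<bar> \<le> M"
proof -
  have "bounded ((singular_source :: 'a \<Rightarrow> real) ` cball 0 (1 / exp 1))"
    by (intro compact_imp_bounded compact_continuous_image continuous_on_subset[OF continuous_singular_source]) auto
  then obtain M where "\<forall>x\<in>cball 0 (1 / exp 1). \<bar>singular_source (x::'a)\<bar> \<le> M"
    unfolding bounded_iff by auto
  then show thesis
    by (intro that[of M]) auto
qed

text \<open>An explicit ball around the origin on which the solution exceeds \<open>C\<close>: there the second factor is at
least half its value at the origin, while the logarithm is as large as needed.\<close>

lemma singular_solution_unbounded:
  "\<not> (AE x in lebesgue_on (ball 0 (1 / exp 1)). singular_solution (x::'a::euclidean_space) \<le> C)"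
proof
  \<comment> \<open>The summand \<open>- 3 / 2\<close> keeps \<open>s\<^sup>3\<close> below \<open>exp (- 6) / 2\<close>; the other one makes \<open>- ln s\<close> exceed
    \<open>4 * \<bar>C\<bar> * exp 6\<close>, which compensates the factor \<open>exp (- 6) / 4\<close>.\<close>
  define \<delta> :: real where "\<delta> = exp (- (3 / 2) - 2 * \<bar>C\<bar> * exp 6)"
  assume "AE x in lebesgue_on (ball 0 (1 / exp 1)). singular_solution (x::'a) \<le> C"
  then have "AE x in lebesgue. x \<in> ball (0::'a) (1 / exp 1) \<longrightarrow> singular_solution x \<le> C"
    by (subst (asm) AE_restrict_space_iff) auto
  moreover have "AE x in lebesgue. x \<noteq> (0::'a)"
    by (rule AE_completion) (rule AE_lborel_singleton)
  ultimately have "AE x in lebesgue. x \<notin> ball (0::'a) \<delta>"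
  proof eventually_elim
    case (elim x)
    show ?case
    proof
      assume x: "x \<in> ball 0 \<delta>"
      define s where "s = x \<bullet> x"
      have "0 < s"
        using elim by (simp add: s_def)
      have "(norm x)\<^sup>2 < \<delta>\<^sup>2"
        using x by (intro power_strict_mono) auto
      then have s: "s < exp (- 3 - 4 * \<bar>C\<bar> * exp 6)"
        by (simp add: s_def \<delta>_def power2_norm_eq_inner exp_of_nat_mult[symmetric] algebra_simps)
      have C: "0 \<le> \<bar>C\<bar> * exp 6"
        by simp
      then have "- (3 / 2) - 2 * \<bar>C\<bar> * exp 6 \<le> - 1"
        by linarith
      then have "\<delta> \<le> exp (- 1)"
        by (simp add: \<delta>_def)
      with x have "x \<in> ball 0 (1 / exp 1)"
        by (auto simp: exp_minus inverse_eq_divide)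
      with elim have le: "singular_solution x \<le> C"
        by simp
      have "ln s < ln (exp (- 3 - 4 * \<bar>C\<bar> * exp 6))"
        using s \<open>0 < s\<close> by (subst ln_less_cancel_iff) auto
      then have ln: "3 + 4 * \<bar>C\<bar> * exp 6 < - ln s"
        by simp
      with C have "ln s \<le> 0"
        by linarith
      have "s ^ 3 \<le> exp (- 3) ^ 3"
        using s \<open>0 < s\<close> by (intro power_mono) (auto elim!: order_trans[OF less_imp_le])
      also have "exp (- 3) ^ 3 = exp (- 6) * exp (- 3 :: real)"
        by (simp add: exp_of_nat_mult[symmetric] exp_add[symmetric])
      also have "\<dots> \<le> exp (- 6) * (1 / 2)"
        using exp_ge_add_one_self[of 3] by (intro mult_left_mono) (auto simp: exp_minus field_simps)
      finally have "exp (- 6) / 2 \<le> exp (- 6) - s ^ 3"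
        by simp
      then have "(1 / 2) * (3 + 4 * \<bar>C\<bar> * exp 6) * (exp (- 6) / 2) \<le> (1 / 2) * - ln s * (exp (- 6) - s ^ 3)"
        using ln \<open>ln s \<le> 0\<close> by (intro mult_mono) auto
      also have "\<dots> = singular_solution x"
        by (simp add: singular_solution_def s_def)
      also note le
      finally have "(1 / 2) * (3 + 4 * \<bar>C\<bar> * exp 6) * (exp (- 6) / 2) \<le> C" .
      moreover have "(1 / 2) * (3 + 4 * \<bar>C\<bar> * exp 6) * (exp (- 6) / 2) = 3 / 4 * exp (- 6) + \<bar>C\<bar>"
        by (simp add: field_simps exp_minus)
      ultimately show False
        using exp_gt_zero[of "- 6 :: real"] by linarith
    qed
  qed
  then have "ball (0::'a) \<delta> \<in> null_sets lebesgue"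
    by (subst AE_iff_null_sets) auto
  then have "measure lebesgue (ball (0::'a) \<delta>) = 0"
    by (simp add: null_sets_def measure_def)
  then show False
    by (simp add: \<delta>_def)
qed

section \<open>Consequences for the Green function\<close>

text \<open>All three bounds produce majorants of \<open>G\<^sub>y\<close> whose integrals are bounded uniformly in \<open>y\<close>. Tested against
the nonnegative bounded source \<open>\<phi>\<close>, such majorants would bound the singular solution, whose value
at \<open>y\<close> is \<open>\<integral> G(x, y) \<phi>(x) dx\<close>. A one-sided majorant suffices because \<open>\<phi> \<ge> 0\<close>.\<close>

lemma no_uniform_integrable_majorant:
  fixes G :: "'a::euclidean_space \<Rightarrow> 'a \<Rightarrow> real"
  defines "B \<equiv> ball 0 (1 / exp 1)"
  assumes "3 \<le> DIM('a)" and G: "greens_function B log_drift G"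
  shows "\<not> (AE y in lebesgue_on B. \<exists>H. integrable (lebesgue_on B) H \<and> (\<forall>x. 0 \<le> H x) \<and>
      (LINT x|lebesgue_on B. H x) \<le> C \<and> (AE x in lebesgue_on B. G x y \<le> H x))"
proof
  assume bound: "AE y in lebesgue_on B. \<exists>H. integrable (lebesgue_on B) H \<and> (\<forall>x. 0 \<le> H x) \<and>
      (LINT x|lebesgue_on B. H x) \<le> C \<and> (AE x in lebesgue_on B. G x y \<le> H x)"
  obtain M where M: "\<And>x::'a. x \<in> B \<Longrightarrow> \<bar>singular_source x\<bar> \<le> M"
    unfolding B_def using singular_source_bounded by blast
  have "0 \<le> M"
    using M[of 0] by (simp add: B_def)
  have meas: "(singular_source :: 'a \<Rightarrow> real) \<in> borel_measurable (lebesgue_on B)"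
    using borel_measurable_continuous_onI[OF continuous_singular_source] by (rule borel_measurable_lebesgue_onI)
  have \<phi>: "AE x::'a in lebesgue_on B. 0 \<le> singular_source x \<and> singular_source x \<le> M"
  proof (rule AE_I2)
    fix x :: 'a assume "x \<in> space (lebesgue_on B)"
    then show "0 \<le> singular_source x \<and> singular_source x \<le> M"
      using M[of x] singular_source_nonneg[of x] by (simp add: B_def)
  qed
  have "(singular_source :: 'a \<Rightarrow> real) \<in> L_infty B"
    unfolding L_infty_def using meas M by (auto intro!: exI[of _ M] AE_I2)
  moreover have "adjoint_weak_solution B log_drift (singular_source :: 'a \<Rightarrow> real) singular_solution"
    unfolding B_def using assms(2) by (rule adjoint_weak_solution_singular)
  ultimately have "AE y in lebesgue_on B. singular_solution y = (LINT x|lebesgue_on B. G x y * singular_source x)"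
    and "AE y in lebesgue_on B. integrable (lebesgue_on B) (\<lambda>x. G x y)"
    using G unfolding greens_function_def by blast+
  with bound have "AE y in lebesgue_on B. singular_solution y \<le> M * C"
  proof eventually_elim
    case (elim y)
    then obtain H where H: "integrable (lebesgue_on B) H" "\<And>x. 0 \<le> H x" "(LINT x|lebesgue_on B. H x) \<le> C"
      "AE x in lebesgue_on B. G x y \<le> H x"
      by blast
    have "singular_solution y = (LINT x|lebesgue_on B. G x y * singular_source x)"
      using elim by simp
    also have "\<dots> \<le> (LINT x|lebesgue_on B. H x * M)"
    proof (rule integral_mono_AE)
      have "integrable (lebesgue_on B) (\<lambda>x. G x y * M)"
        using elim by simp
      then show "integrable (lebesgue_on B) (\<lambda>x. G x y * singular_source x)"
      proof (rule Bochner_Integration.integrable_bound)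
        show "AE x in lebesgue_on B. norm (G x y * singular_source x) \<le> norm (G x y * M)"
          using \<phi> by eventually_elim (auto simp: abs_mult intro!: mult_left_mono)
      qed (use elim meas in \<open>auto intro!: borel_measurable_times\<close>)
      show "integrable (lebesgue_on B) (\<lambda>x. H x * M)"
        using H(1) by simp
      show "AE x in lebesgue_on B. G x y * singular_source x \<le> H x * M"
        using \<phi> H(4) 
      proof eventually_elim
        case (elim x)
        then have "G x y * singular_source x \<le> H x * singular_source x"
          by (intro mult_right_mono) auto
        also have "\<dots> \<le> H x * M"
          using elim H(2) by (intro mult_left_mono) auto
        finally show ?case .
      qed
    qed
    also have "\<dots> \<le> M * C"
      using mult_left_mono[OF H(3) \<open>0 \<le> M\<close>] by (simp add: mult.commute)
    finally show ?case .
  qed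
  then show False
    using singular_solution_unbounded unfolding B_def by blast
qed

lemma measure_le_of_weak_Lp_norm:
  assumes "0 < p" and "weak_Lp_norm \<Omega> p f \<le> ennreal C" and "0 \<le> C" and "0 < t"
  shows "measure (lebesgue_on \<Omega>) {x \<in> \<Omega>. t \<le> \<bar>f x\<bar>} \<le> C powr p * t powr - p"
proof -
  define \<mu> where "\<mu> = measure (lebesgue_on \<Omega>) {x \<in> \<Omega>. t \<le> \<bar>f x\<bar>}"
  have "ennreal (t * \<mu> powr (1 / p)) \<le> weak_Lp_norm \<Omega> p f"
    unfolding weak_Lp_norm_def \<mu>_def using \<open>0 < t\<close> by (intro SUP_upper) auto
  with assms(2) have "ennreal (t * \<mu> powr (1 / p)) \<le> ennreal C"
    by (rule order_trans[rotated])
  then have "t * \<mu> powr (1 / p) \<le> C"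
    using \<open>0 \<le> C\<close> by (simp add: ennreal_le_iff)
  then have "\<mu> powr (1 / p) \<le> C / t"
    using \<open>0 < t\<close> by (simp add: field_simps)
  then have "(\<mu> powr (1 / p)) powr p \<le> (C / t) powr p"
    using \<open>0 < p\<close> by (intro powr_mono2) auto
  moreover have "(\<mu> powr (1 / p)) powr p = \<mu>"
    using \<open>0 < p\<close> by (simp add: powr_powr \<mu>_def)
  moreover have "(C / t) powr p = C powr p * t powr - p"
    using assms by (simp add: powr_divide powr_minus_divide)
  ultimately show ?thesis
    by (simp add: \<mu>_def)
qed

theorem proposition7p5:
  fixes G :: "real ^ 'n \<Rightarrow> real ^ 'n \<Rightarrow> real"
    and B :: "(real ^ 'n) set"
  defines "B \<equiv> ball 0 (1 / exp 1)"
  assumes "CARD('n) \<ge> 3"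
    and "greens_function B log_drift G"
  shows "(\<nexists>C::real. AE y in lebesgue_on B. (LINT x|lebesgue_on B. \<bar>G x y\<bar>) \<le> C) \<and>
         (\<nexists>C::real. AE y in lebesgue_on B. AE x in lebesgue_on B.
            G x y \<le> C * norm (x - y) powr (2 - real CARD('n))) \<and>
         (\<nexists>C::real. AE y in lebesgue_on B.
            weak_Lp_norm B (real CARD('n) / (real CARD('n) - 2)) (\<lambda>x. G x y) \<le> ennreal C)"
proof -
  have dim: "DIM(real ^ 'n) = CARD('n)"
    by simp
  interpret finite_measure "lebesgue_on B"
    unfolding B_def by (rule finite_measure_lebesgue_on_ball)
  note unbounded = no_uniform_integrable_majorant[where G = G, unfolded dim, folded B_def, OF assms(2,3)]
  have integrable: "AE y in lebesgue_on B. integrable (lebesgue_on B) (\<lambda>x. G x y)"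
    using assms(3) by (simp add: greens_function_def)
  have L1: "\<not> (AE y in lebesgue_on B. (LINT x|lebesgue_on B. \<bar>G x y\<bar>) \<le> C)" for C
  proof
    assume "AE y in lebesgue_on B. (LINT x|lebesgue_on B. \<bar>G x y\<bar>) \<le> C"
    with integrable have "AE y in lebesgue_on B. \<exists>H. integrable (lebesgue_on B) H \<and> (\<forall>x. 0 \<le> H x) \<and>
        (LINT x|lebesgue_on B. H x) \<le> C \<and> (AE x in lebesgue_on B. G x y \<le> H x)"
    proof eventually_elim
      case (elim y)
      then show ?case
        by (intro exI[of _ "\<lambda>x. \<bar>G x y\<bar>"]) auto
    qed
    with unbounded show False
      by blast
  qed
  have pointwise: "\<not> (AE y in lebesgue_on B. AE x in lebesgue_on B.
      G x y \<le> C * norm (x - y) powr (2 - real CARD('n)))" for C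
  proof
    assume bound: "AE y in lebesgue_on B. AE x in lebesgue_on B. G x y \<le> C * norm (x - y) powr (2 - real CARD('n))"
    have "0 < real CARD('n) - 2" "real CARD('n) - 2 < real DIM(real ^ 'n)"
      using assms(2) by simp_all
    then obtain K where K:
      "\<And>y::real ^ 'n. integrable (lebesgue_on B) (\<lambda>x. norm (x - y) powr (2 - real CARD('n)))"
      "\<And>y::real ^ 'n. (LINT x|lebesgue_on B. norm (x - y) powr (2 - real CARD('n))) \<le> K"
      unfolding B_def using norm_powr_integral_bound[of "real CARD('n) - 2" "0 :: real ^ 'n" "1 / exp 1"] by auto
    from bound have "AE y in lebesgue_on B. \<exists>H. integrable (lebesgue_on B) H \<and> (\<forall>x. 0 \<le> H x) \<and>
        (LINT x|lebesgue_on B. H x) \<le> \<bar>C\<bar> * K \<and> (AE x in lebesgue_on B. G x y \<le> H x)"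
    proof eventually_elim
      case (elim y)
      have "AE x in lebesgue_on B. G x y \<le> \<bar>C\<bar> * norm (x - y) powr (2 - real CARD('n))"
        using elim
        by eventually_elim (rule order_trans, assumption, intro mult_right_mono, auto)
      moreover have "(LINT x|lebesgue_on B. \<bar>C\<bar> * norm (x - y) powr (2 - real CARD('n))) \<le> \<bar>C\<bar> * K"
        using K(2)[of y] by (simp add: mult_left_mono)
      ultimately show ?case
        using K(1)[of y] by (intro exI[of _ "\<lambda>x. \<bar>C\<bar> * norm (x - y) powr (2 - real CARD('n))"]) auto
    qed
    with unbounded show False
      by blast
  qed
  have weak: "\<not> (AE y in lebesgue_on B.
      weak_Lp_norm B (real CARD('n) / (real CARD('n) - 2)) (\<lambda>x. G x y) \<le> ennreal C)" for C
  proof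
    define p where "p = real CARD('n) / (real CARD('n) - 2)"
    have "1 < p"
      using assms(2) by (simp add: p_def)
    assume "AE y in lebesgue_on B. weak_Lp_norm B (real CARD('n) / (real CARD('n) - 2)) (\<lambda>x. G x y) \<le> ennreal C"
    with integrable have "AE y in lebesgue_on B. (LINT x|lebesgue_on B. \<bar>G x y\<bar>) \<le>
        measure (lebesgue_on B) (space (lebesgue_on B)) + 2 * (max 0 C powr p) / (1 - 2 powr (1 - p))"
    proof eventually_elim
      case (elim y)
      \<comment> \<open>For negative \<open>C\<close> the bound \<open>ennreal C\<close> is \<open>0\<close>.\<close>
      have "weak_Lp_norm B p (\<lambda>x. G x y) \<le> ennreal (max 0 C)"
        using elim by (simp add: p_def ennreal_max_0)
      from measure_le_of_weak_Lp_norm[OF _ this] elim show ?case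
        using \<open>1 < p\<close> by (intro weak_type_integral_bound(2)) auto
    qed
    with L1 show False
      by blast
  qed
  show ?thesis
    using L1 pointwise weak by blast
qed

end
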